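(* Let $h\ge 4$ be an integer, and call a graph extremal if it is a connected graph with $\chi(G)=\Gamma(G)=3$ and $\psi(G)=h$ having the minimum possible number of vertices among all such connected graphs (this minimum is $2h-2$). Up to isomorphism, there are exactly seven extremal graphs if $h=4$, exactly three if $h=5$, and exactly two for every $h\ge 6$.
   Context: All graphs are finite, simple and undirected. A complete $k$-coloring of a graph $G=(V,E)$ is a map $\varphi:V\to\{1,\dots,k\}$, using all $k$ colors, such that adjacent vertices get different colors and for any two colors $i\neq j$ there is an edge between the color classes $i$ and $j$. $\chi(G)$ is the chromatic number; the achromatic number $\psi(G)$ is the maximum $k$ for which $G$ has a complete $k$-coloring. A Grundy coloring is a proper coloring $\varphi:V\to\{1,\dots,k\}$ such that every vertex $v$ has a neighbor of color $i$ for every $1\le i<\varphi(v)$; the Grundy number $\Gamma(G)$ is the largest $k$ for which $G$ has a Grundy coloring with $k$ colors. *)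

theory Defs
  imports
    "Graph_Theory.Pair_Digraph"
    "Graph_Theory.Digraph_Isomorphism"
    "HOL-Library.Infinite_Typeclass"
begin

text \<open>
  Finite simple undirected graphs are the \<^locale>\<open>pair_graph\<close> digraphs: every edge is
  represented by the two arcs \<open>(u, v)\<close> and \<open>(v, u)\<close>.  On them \<^const>\<open>digraph_iso\<close> is
  ordinary graph isomorphism.
\<close>

definition proper_coloring :: "'a pair_pre_digraph \<Rightarrow> nat \<Rightarrow> ('a \<Rightarrow> nat) \<Rightarrow> bool" where
  "proper_coloring G k \<phi> \<longleftrightarrow>
     \<phi> ` pverts G \<subseteq> {1..k} \<and> (\<forall>(u, v) \<in> parcs G. \<phi> u \<noteq> \<phi> v)"

definition complete_coloring :: "'a pair_pre_digraph \<Rightarrow> nat \<Rightarrow> ('a \<Rightarrow> nat) \<Rightarrow> bool" where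
  "complete_coloring G k \<phi> \<longleftrightarrow>
     proper_coloring G k \<phi> \<and> \<phi> ` pverts G = {1..k} \<and>
     (\<forall>i \<in> {1..k}. \<forall>j \<in> {1..k}. i \<noteq> j \<longrightarrow> (\<exists>(u, v) \<in> parcs G. \<phi> u = i \<and> \<phi> v = j))"

text \<open>
  As for complete colorings, all \<open>k\<close> colors have to be used; otherwise \<open>k\<close> could be
  increased arbitrarily and the Grundy number would not be defined.
\<close>

definition grundy_coloring :: "'a pair_pre_digraph \<Rightarrow> nat \<Rightarrow> ('a \<Rightarrow> nat) \<Rightarrow> bool" where
  "grundy_coloring G k \<phi> \<longleftrightarrow>
     proper_coloring G k \<phi> \<and> \<phi> ` pverts G = {1..k} \<and>
     (\<forall>v \<in> pverts G. \<forall>i. 1 \<le> i \<and> i < \<phi> v \<longrightarrow> (\<exists>u. (v, u) \<in> parcs G \<and> \<phi> u = i))"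

definition chromatic_number :: "'a pair_pre_digraph \<Rightarrow> nat" where
  "chromatic_number G = (LEAST k. \<exists>\<phi>. proper_coloring G k \<phi>)"

definition achromatic_number :: "'a pair_pre_digraph \<Rightarrow> nat" where
  "achromatic_number G = Max {k. \<exists>\<phi>. complete_coloring G k \<phi>}"

definition grundy_number :: "'a pair_pre_digraph \<Rightarrow> nat" where
  "grundy_number G = Max {k. \<exists>\<phi>. grundy_coloring G k \<phi>}"

definition candidate_graphs :: "nat \<Rightarrow> 'a pair_pre_digraph set" where
  "candidate_graphs h =
     {G. pair_graph G \<and> connected (with_proj G) \<and>
         chromatic_number G = 3 \<and> grundy_number G = 3 \<and> achromatic_number G = h}"

text \<open>
  The vertex type is infinite, so it contains a copy of every finite graph and the minimum
  below is the minimum over all finite graphs.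
\<close>

definition extremal_graphs :: "nat \<Rightarrow> 'a::infinite pair_pre_digraph set" where
  "extremal_graphs h =
     {G \<in> candidate_graphs h.
        \<forall>H \<in> (candidate_graphs h :: 'a pair_pre_digraph set). card (pverts G) \<le> card (pverts H)}"

definition graph_iso_rel :: "('a pair_pre_digraph \<times> 'a pair_pre_digraph) set" where
  "graph_iso_rel =
     {(G, H). pair_graph G \<and> pair_graph H \<and> digraph_iso (with_proj G) (with_proj H)}"

end

theory Submission
  imports Defs
begin

text \<open>
  In a complete coloring with \<open>h\<close> colors, three singleton classes together with any fourth class
  would give a Grundy coloring with four colors, so at most two classes are singletons and there are
  at least \<open>2h - 2\<close> vertices.  In case of equality the graph consists of two adjacent hubs and
  \<open>h - 2\<close> pairs.  Two pairs \<open>P\<close>, \<open>Q\<close> are joined by exactly one edge: otherwise every vertex of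
  \<open>Q\<close>, say, has a neighbor in \<open>P\<close>, and \<open>P\<close>, \<open>Q\<close> and the two hubs are the classes of a Grundy
  coloring.  The graph is thus determined by the way each pair is attached to the hubs and by the ends
  of the edges between the pairs.  Excluding Grundy colorings with four colors on two or three
  pairs leaves, for at least three pairs, only two infinite families (half graphs with
  one or two extra vertices attached to both hubs) and one sporadic graph with three pairs;
  for two pairs seven graphs remain.
\<close>

section \<open>Graph isomorphism\<close>

text \<open>A Grundy coloring of an induced subgraph extends greedily to the whole graph, so a bound
  on the Grundy number can be refuted on a few vertices. This is why the exclusions need only look
  at the hubs and two or three pairs. The hubs serve so well because the vertex of a singleton class
  has a neighbor in every other class and can take any high color. The converse, that a model has
  Grundy number at most 3, concerns all vertices at once. Graphs of fixed size are left to an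
  exhaustive search; the two families grow with \<open>h\<close> and need a structural reason, a
  bipartite graph with nested neighborhoods plus a few vertices of degree two. The achromatic number
  of a model costs nothing by contrast: more than \<open>h\<close> colors would need more than 2h -
  2 vertices. The models live on one concrete vertex type and the extremal graphs on an arbitrary
  infinite one, so isomorphism has to relate graphs on different types.\<close>

lemma pair_graph_iff:
  "pair_graph G \<longleftrightarrow>
     finite (pverts G) \<and> parcs G \<subseteq> pverts G \<times> pverts G \<and> sym (parcs G) \<and> irrefl (parcs G)"
proof
  assume "pair_graph G"
  then interpret pair_graph G .
  show "finite (pverts G) \<and> parcs G \<subseteq> pverts G \<times> pverts G \<and> sym (parcs G) \<and> irrefl (parcs G)"
    using pair_finite_verts in_arcsD1 in_arcsD2 arcs_symmetric no_loops'
    by (auto simp: irrefl_def intro!: symI) blast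
next
  assume a: "finite (pverts G) \<and> parcs G \<subseteq> pverts G \<times> pverts G \<and> sym (parcs G) \<and> irrefl (parcs G)"
  moreover from a have "finite (parcs G)"
    by (meson finite_SigmaI rev_finite_subset)
  ultimately show "pair_graph G"
    by unfold_locales (auto simp: symmetric_def irrefl_def)
qed

text \<open>In this form connectedness says that no nonempty proper vertex set is closed under arcs,
  which is easier to prove and to refute than reachability. For the converse, the set reached from
  \<open>u\<close> is itself closed.\<close>

lemma pair_graph_connected_iff:
  assumes "pair_graph G"
  shows "connected (with_proj G) \<longleftrightarrow> pverts G \<noteq> {} \<and>
    (\<forall>S \<subseteq> pverts G. S \<noteq> {} \<longrightarrow> (\<forall>(u, v) \<in> parcs G. u \<in> S \<longrightarrow> v \<in> S) \<longrightarrow> S = pverts G)"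
    (is "?L \<longleftrightarrow> ?R")
proof -
  interpret pair_graph G by fact
  have "(parcs G)\<^sup>s = parcs G"
    using arcs_symmetric by (auto simp: symcl_def)
  then have conn: "?L \<longleftrightarrow> pverts G \<noteq> {} \<and> (\<forall>u \<in> pverts G. \<forall>v \<in> pverts G. (u, v) \<in> rtrancl_on (pverts G) (parcs G))"
    by (simp add: connected_conv)
  show ?thesis
  proof
    assume ?L
    have "v \<in> S" if S: "S \<subseteq> pverts G" "u \<in> S" "\<forall>(u, v) \<in> parcs G. u \<in> S \<longrightarrow> v \<in> S"
      and v: "v \<in> pverts G" for S u v
    proof -
      have "(u, v) \<in> rtrancl_on (pverts G) (parcs G)"
        using \<open>?L\<close> conn S v by auto
      then show ?thesis
        by (induct rule: rtrancl_on_induct) (use S in auto)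
    qed
    then show ?R using \<open>?L\<close> conn by blast
  next
    assume R: ?R
    have "(u, v) \<in> rtrancl_on (pverts G) (parcs G)" if u: "u \<in> pverts G" and v: "v \<in> pverts G" for u v
    proof -
      let ?S = "{w \<in> pverts G. (u, w) \<in> rtrancl_on (pverts G) (parcs G)}"
      have "u \<in> ?S" using u by simp
      moreover have "\<forall>(x, y) \<in> parcs G. x \<in> ?S \<longrightarrow> y \<in> ?S"
        using in_arcsD1 in_arcsD2 by (auto intro: rtrancl_on_into_rtrancl_on)
      ultimately have "?S = pverts G" using R by blast
      then show ?thesis using v by blast
    qed
    then show ?L using R conn by blast
  qed
qed

lemma connected_closed_set:
  assumes "pair_graph G" "connected (with_proj G)" "S \<subseteq> pverts G" "S \<noteq> {}"
    and "\<And>u v. (u, v) \<in> parcs G \<Longrightarrow> u \<in> S \<Longrightarrow> v \<in> S"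
  shows "S = pverts G"
proof -
  have "\<forall>(u, v) \<in> parcs G. u \<in> S \<longrightarrow> v \<in> S" using assms(5) by blast
  then show ?thesis using assms(2-4) unfolding pair_graph_connected_iff[OF assms(1)] by blast
qed

text \<open>\<open>digraph_iso\<close> also carries a map on arcs and head and tail functions for
  the target. Between pair graphs all of these are determined by the vertex map, so a bijection of
  vertices that preserves and reflects arcs is enough.\<close>

definition isomorphic :: "'a pair_pre_digraph \<Rightarrow> 'b pair_pre_digraph \<Rightarrow> bool" where
  "isomorphic G H \<longleftrightarrow> (\<exists>f. bij_betw f (pverts G) (pverts H) \<and>
     (\<forall>u \<in> pverts G. \<forall>v \<in> pverts G. (f u, f v) \<in> parcs H \<longleftrightarrow> (u, v) \<in> parcs G))"

lemma isomorphic_refl: "isomorphic G G"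
  unfolding isomorphic_def by (rule exI[of _ id]) auto

lemma isomorphic_sym:
  assumes "isomorphic G H"
  shows "isomorphic H G"
proof -
  obtain f where f: "bij_betw f (pverts G) (pverts H)"
    "\<forall>u \<in> pverts G. \<forall>v \<in> pverts G. (f u, f v) \<in> parcs H \<longleftrightarrow> (u, v) \<in> parcs G"
    using assms by (auto simp: isomorphic_def)
  let ?g = "the_inv_into (pverts G) f"
  have g: "bij_betw ?g (pverts H) (pverts G)"
    using f(1) by (rule bij_betw_the_inv_into)
  moreover have "f (?g u) = u" if "u \<in> pverts H" for u
    using f(1) that by (metis bij_betw_def f_the_inv_into_f)
  moreover have "?g u \<in> pverts G" if "u \<in> pverts H" for u
    using g that bij_betwE by blast
  ultimately show ?thesis
    unfolding isomorphic_def using f(2) by (metis (lifting))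
qed

lemma isomorphic_trans:
  assumes "isomorphic G H" "isomorphic H K"
  shows "isomorphic G K"
proof -
  obtain f where f: "bij_betw f (pverts G) (pverts H)"
    "\<forall>u \<in> pverts G. \<forall>v \<in> pverts G. (f u, f v) \<in> parcs H \<longleftrightarrow> (u, v) \<in> parcs G"
    using assms by (auto simp: isomorphic_def)
  obtain g where g: "bij_betw g (pverts H) (pverts K)"
    "\<forall>u \<in> pverts H. \<forall>v \<in> pverts H. (g u, g v) \<in> parcs K \<longleftrightarrow> (u, v) \<in> parcs H"
    using assms by (auto simp: isomorphic_def)
  have "bij_betw (g \<circ> f) (pverts G) (pverts K)"
    using f(1) g(1) by (rule bij_betw_trans)
  moreover have "f u \<in> pverts H" if "u \<in> pverts G" for u
    using f(1) that bij_betwE by blast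
  ultimately show ?thesis
    unfolding isomorphic_def using f(2) g(2) by (intro exI[of _ "g \<circ> f"]) auto
qed

text \<open>In \<open>with_proj H\<close> the head and tail functions are the projections, which
  forces an isomorphism to send an arc \<open>(u, v)\<close> to the pair of images. Conversely,
  \<open>map_prod f f\<close> serves as the arc map.\<close>

lemma digraph_iso_iff_isomorphic:
  assumes "pair_graph G" "pair_graph H"
  shows "digraph_iso (with_proj G) (with_proj H) \<longleftrightarrow> isomorphic G H"
proof
  interpret G: pair_graph G by fact
  interpret H: pair_graph H by fact
  assume "digraph_iso (with_proj G) (with_proj H)"
  then obtain I where I: "G.digraph_isomorphism I" "with_proj H = app_iso I (with_proj G)"
    by (auto simp: digraph_iso_def)
  let ?f = "iso_verts I"
  have V: "pverts H = ?f ` pverts G" and A: "parcs H = iso_arcs I ` parcs G"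
    and ends: "iso_tail I = fst" "iso_head I = snd"
    using I(2) by (auto simp: with_proj_def app_iso_def)
  have inj: "inj_on ?f (pverts G)"
    using I(1) by (auto simp: G.digraph_isomorphism_def)
  have arc: "iso_arcs I (u, v) = (?f u, ?f v)" if "(u, v) \<in> parcs G" for u v
    using I(1) that ends by (force simp: G.digraph_isomorphism_def prod_eq_iff)
  have "(?f u, ?f v) \<in> parcs H \<longleftrightarrow> (u, v) \<in> parcs G" if "u \<in> pverts G" "v \<in> pverts G" for u v
  proof
    assume "(?f u, ?f v) \<in> parcs H"
    then obtain x y where xy: "(x, y) \<in> parcs G" "(?f u, ?f v) = iso_arcs I (x, y)"
      using A by auto
    then have "?f u = ?f x" "?f v = ?f y" using arc by auto
    then show "(u, v) \<in> parcs G"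
      using xy(1) that inj G.in_arcsD1 G.in_arcsD2 by (metis inj_onD)
  next
    assume "(u, v) \<in> parcs G"
    then show "(?f u, ?f v) \<in> parcs H" using A arc by force
  qed
  then show "isomorphic G H"
    unfolding isomorphic_def using V inj by (auto simp: bij_betw_def)
next
  interpret G: pair_graph G by fact
  interpret H: pair_graph H by fact
  assume "isomorphic G H"
  then obtain f where f: "bij_betw f (pverts G) (pverts H)"
    "\<forall>u \<in> pverts G. \<forall>v \<in> pverts G. (f u, f v) \<in> parcs H \<longleftrightarrow> (u, v) \<in> parcs G"
    by (auto simp: isomorphic_def)
  define I where "I = \<lparr>iso_verts = f, iso_arcs = map_prod f f, iso_head = snd, iso_tail = fst\<rparr>"
  have inj: "inj_on f (pverts G)" and V: "pverts H = f ` pverts G"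
    using f(1) by (auto simp: bij_betw_def)
  have "inj_on (map_prod f f) (parcs G)"
    by (rule inj_on_subset[OF map_prod_inj_on[OF inj inj]]) (auto dest: G.in_arcsD1 G.in_arcsD2)
  then have "G.digraph_isomorphism I"
    using inj by (auto simp: G.digraph_isomorphism_def I_def intro: G.wf_digraph_axioms)
  moreover have "parcs H = map_prod f f ` parcs G"
  proof (intro equalityI subsetI)
    fix e assume e: "e \<in> parcs H"
    obtain x y where xy: "e = (x, y)" by fastforce
    then have "x \<in> pverts H" "y \<in> pverts H" using e H.in_arcsD1 H.in_arcsD2 by auto
    then obtain u v where uv: "u \<in> pverts G" "v \<in> pverts G" "x = f u" "y = f v" using V by auto
    then have "(u, v) \<in> parcs G" using f(2) e xy by auto
    then show "e \<in> map_prod f f ` parcs G" using xy uv by force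
  next
    fix e assume "e \<in> map_prod f f ` parcs G"
    then show "e \<in> parcs H" using f(2) by (auto dest: G.in_arcsD1 G.in_arcsD2)
  qed
  then have "with_proj H = app_iso I (with_proj G)"
    using V by (simp add: with_proj_def app_iso_def I_def)
  ultimately show "digraph_iso (with_proj G) (with_proj H)"
    by (auto simp: digraph_iso_def)
qed

lemma proper_coloring_comp:
  assumes "pair_graph G" "f ` pverts G \<subseteq> pverts H" "proper_coloring H k \<phi>"
    and "\<And>u v. (u, v) \<in> parcs G \<Longrightarrow> (f u, f v) \<in> parcs H"
  shows "proper_coloring G k (\<phi> \<circ> f)"
  using assms unfolding proper_coloring_def by (fastforce simp: image_subset_iff)

lemma complete_coloring_isomorphic:
  assumes "pair_graph G" "pair_graph H" "isomorphic G H" "complete_coloring H k \<phi>"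
  shows "\<exists>\<phi>. complete_coloring G k \<phi>"
proof -
  interpret G: pair_graph G by fact
  interpret H: pair_graph H by fact
  obtain f where f: "f ` pverts G = pverts H"
    "\<And>u v. u \<in> pverts G \<Longrightarrow> v \<in> pverts G \<Longrightarrow> (f u, f v) \<in> parcs H \<longleftrightarrow> (u, v) \<in> parcs G"
    using assms(3) by (auto simp: isomorphic_def bij_betw_def)
  have "\<exists>(u, v) \<in> parcs G. \<phi> (f u) = i \<and> \<phi> (f v) = j"
    if "i \<in> {1..k}" "j \<in> {1..k}" "i \<noteq> j" for i j
  proof -
    obtain x y where xy: "(x, y) \<in> parcs H" "\<phi> x = i" "\<phi> y = j"
      using assms(4) \<open>i \<in> {1..k}\<close> \<open>j \<in> {1..k}\<close> \<open>i \<noteq> j\<close> unfolding complete_coloring_def by blast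
    obtain u v where "u \<in> pverts G" "v \<in> pverts G" "x = f u" "y = f v"
      using f(1) H.in_arcsD1[OF xy(1)] H.in_arcsD2[OF xy(1)] by blast
    then show ?thesis using xy f(2) by (intro bexI[of _ "(u, v)"]) auto
  qed
  moreover have "proper_coloring G k (\<phi> \<circ> f)"
    using assms(4) f unfolding complete_coloring_def
    by (intro proper_coloring_comp[OF assms(1)]) (use G.in_arcsD1 G.in_arcsD2 in blast)+
  moreover have "(\<phi> \<circ> f) ` pverts G = {1..k}"
    using assms(4) f(1) unfolding complete_coloring_def by (metis image_comp)
  ultimately show ?thesis
    unfolding complete_coloring_def by (intro exI[of _ "\<phi> \<circ> f"]) auto
qed

lemma grundy_coloring_isomorphic:
  assumes "pair_graph G" "pair_graph H" "isomorphic G H" "grundy_coloring H k \<phi>"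
  shows "\<exists>\<phi>. grundy_coloring G k \<phi>"
proof -
  interpret G: pair_graph G by fact
  interpret H: pair_graph H by fact
  obtain f where f: "f ` pverts G = pverts H"
    "\<And>u v. u \<in> pverts G \<Longrightarrow> v \<in> pverts G \<Longrightarrow> (f u, f v) \<in> parcs H \<longleftrightarrow> (u, v) \<in> parcs G"
    using assms(3) by (auto simp: isomorphic_def bij_betw_def)
  have "\<exists>u. (v, u) \<in> parcs G \<and> \<phi> (f u) = i"
    if v: "v \<in> pverts G" and i: "1 \<le> i" "i < \<phi> (f v)" for v i
  proof -
    have "f v \<in> pverts H" using v f(1) by blast
    then obtain x where x: "(f v, x) \<in> parcs H" "\<phi> x = i"
      using assms(4) i unfolding grundy_coloring_def by blast
    then obtain u where "u \<in> pverts G" "x = f u"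
      using f(1) H.in_arcsD2 by blast
    then show ?thesis using x v f(2) by blast
  qed
  moreover have "proper_coloring G k (\<phi> \<circ> f)"
    using assms(4) f unfolding grundy_coloring_def
    by (intro proper_coloring_comp[OF assms(1)]) (use G.in_arcsD1 G.in_arcsD2 in blast)+
  moreover have "(\<phi> \<circ> f) ` pverts G = {1..k}"
    using assms(4) f(1) unfolding grundy_coloring_def by (metis image_comp)
  ultimately show ?thesis
    unfolding grundy_coloring_def by (intro exI[of _ "\<phi> \<circ> f"]) auto
qed

lemma proper_coloring_isomorphic:
  assumes "pair_graph G" "pair_graph H" "isomorphic G H" "proper_coloring H k \<phi>"
  shows "\<exists>\<phi>. proper_coloring G k \<phi>"
proof -
  interpret G: pair_graph G by fact
  obtain f where "f ` pverts G = pverts H"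
    "\<And>u v. u \<in> pverts G \<Longrightarrow> v \<in> pverts G \<Longrightarrow> (f u, f v) \<in> parcs H \<longleftrightarrow> (u, v) \<in> parcs G"
    using assms(3) by (auto simp: isomorphic_def bij_betw_def)
  then have "proper_coloring G k (\<phi> \<circ> f)"
    by (intro proper_coloring_comp[OF assms(1) _ assms(4)]) (use G.in_arcsD1 G.in_arcsD2 in blast)+
  then show ?thesis by blast
qed

lemma connected_isomorphic:
  assumes G: "pair_graph G" and H: "pair_graph H" and iso: "isomorphic G H"
    and conn: "connected (with_proj H)"
  shows "connected (with_proj G)"
proof -
  interpret G: pair_graph G by fact
  interpret H: pair_graph H by fact
  obtain f where f: "inj_on f (pverts G)" "f ` pverts G = pverts H"
    "\<And>u v. u \<in> pverts G \<Longrightarrow> v \<in> pverts G \<Longrightarrow> (f u, f v) \<in> parcs H \<longleftrightarrow> (u, v) \<in> parcs G"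
    using iso by (auto simp: isomorphic_def bij_betw_def)
  have "S = pverts G" if S: "S \<subseteq> pverts G" "S \<noteq> {}" "\<forall>(u, v) \<in> parcs G. u \<in> S \<longrightarrow> v \<in> S" for S
  proof -
    have "\<forall>(x, y) \<in> parcs H. x \<in> f ` S \<longrightarrow> y \<in> f ` S"
    proof (clarify)
      fix x y u assume a: "(f u, y) \<in> parcs H" "u \<in> S"
      then obtain v where "v \<in> pverts G" "y = f v"
        using f(2) H.in_arcsD2 by blast
      then show "y \<in> f ` S" using a S f(3) by blast
    qed
    then have "f ` S = pverts H"
      using conn pair_graph_connected_iff[OF H] S(1,2) f(2)
      by (metis image_is_empty image_mono)
    then show ?thesis using f(1,2) S(1) by (metis inj_on_image_eq_iff order_refl)
  qed
  moreover have "pverts G \<noteq> {}"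
    using conn pair_graph_connected_iff[OF H] f(2) by auto
  ultimately show ?thesis
    using pair_graph_connected_iff[OF G] by blast
qed

lemma candidate_graphs_isomorphic:
  assumes "pair_graph G" "isomorphic G H" "H \<in> candidate_graphs h"
  shows "G \<in> candidate_graphs h"
proof -
  have H: "pair_graph H" using assms(3) by (simp add: candidate_graphs_def)
  note iso = assms(2) isomorphic_sym[OF assms(2)]
  have "(\<exists>\<phi>. proper_coloring G k \<phi>) \<longleftrightarrow> (\<exists>\<phi>. proper_coloring H k \<phi>)" for k
    using iso assms(1) H proper_coloring_isomorphic by metis
  moreover have "(\<exists>\<phi>. grundy_coloring G k \<phi>) \<longleftrightarrow> (\<exists>\<phi>. grundy_coloring H k \<phi>)" for k
    using iso assms(1) H grundy_coloring_isomorphic by metis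
  moreover have "(\<exists>\<phi>. complete_coloring G k \<phi>) \<longleftrightarrow> (\<exists>\<phi>. complete_coloring H k \<phi>)" for k
    using iso assms(1) H complete_coloring_isomorphic by metis
  ultimately show ?thesis
    using assms connected_isomorphic[OF assms(1) H iso(1)]
    by (simp add: candidate_graphs_def chromatic_number_def grundy_number_def achromatic_number_def)
qed

section \<open>Partial Grundy colorings\<close>

text \<open>A Grundy coloring of the subgraph induced by \<open>W\<close>, with no number of colors
  prescribed: a vertex of color \<open>i\<close> forces all smaller colors to occur among its
  neighbors.\<close>

definition partial_grundy :: "'a pair_pre_digraph \<Rightarrow> 'a set \<Rightarrow> ('a \<Rightarrow> nat) \<Rightarrow> bool" where
  "partial_grundy G W c \<longleftrightarrow> W \<subseteq> pverts G \<and> (\<forall>v \<in> W. 1 \<le> c v) \<and>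
     (\<forall>u \<in> W. \<forall>v \<in> W. (u, v) \<in> parcs G \<longrightarrow> c u \<noteq> c v) \<and>
     (\<forall>v \<in> W. \<forall>i. 1 \<le> i \<and> i < c v \<longrightarrow> (\<exists>u \<in> W. (v, u) \<in> parcs G \<and> c u = i))"

text \<open>The bound is demanded of all partial Grundy colorings, so that it passes to induced
  subgraphs and can be refuted by a configuration on few vertices.\<close>

definition grundy_le :: "'a pair_pre_digraph \<Rightarrow> nat \<Rightarrow> bool" where
  "grundy_le G b \<longleftrightarrow> (\<forall>W c. partial_grundy G W c \<longrightarrow> (\<forall>v \<in> W. c v \<le> b))"

text \<open>First fit: a new vertex receives the least positive color that is free among its colored
  neighbors. By minimality it sees every smaller color, and the old vertices keep their
  witnesses.\<close>

lemma partial_grundy_extend: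
  assumes "pair_graph G" "partial_grundy G W c"
  shows "\<exists>c'. partial_grundy G (pverts G) c' \<and> (\<forall>v \<in> W. c' v = c v)"
proof -
  interpret pair_graph G by fact
  have "finite (pverts G - W)" using pair_finite_verts by blast
  then show ?thesis using assms(2)
  proof (induction "pverts G - W" arbitrary: W c rule: finite_induct)
    case empty
    then have "W = pverts G" by (auto simp: partial_grundy_def)
    then show ?case using empty by auto
  next
    case (insert x F)
    have x: "x \<in> pverts G" "x \<notin> W" and F: "F = pverts G - insert x W"
      using insert.hyps by auto
    have fin: "finite W"
      using insert.prems pair_finite_verts by (auto simp: partial_grundy_def intro: finite_subset)
    let ?free = "\<lambda>i. 1 \<le> i \<and> (\<forall>u \<in> W. (x, u) \<in> parcs G \<longrightarrow> c u \<noteq> i)"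
    define m where "m = (LEAST i. ?free i)"
    have "c u \<noteq> Suc (Max (c ` W))" if "u \<in> W" for u
      using that fin by (metis Max_ge Suc_n_not_le_n finite_imageI imageI)
    then have "?free (Suc (Max (c ` W)))" by auto
    then have m: "?free m" unfolding m_def by (rule LeastI)
    have small: "\<exists>u \<in> W. (x, u) \<in> parcs G \<and> c u = i" if "1 \<le> i" "i < m" for i
      using not_less_Least[of i ?free] that unfolding m_def by blast
    let ?c = "c(x := m)"
    have "partial_grundy G (insert x W) ?c"
      unfolding partial_grundy_def
    proof (intro conjI ballI allI impI)
      show "insert x W \<subseteq> pverts G"
        using insert.prems x by (auto simp: partial_grundy_def)
      show "1 \<le> ?c v" if "v \<in> insert x W" for v
        using insert.prems that m by (auto simp: partial_grundy_def)
      show "?c u \<noteq> ?c v" if "u \<in> insert x W" "v \<in> insert x W" "(u, v) \<in> parcs G" for u v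
        using insert.prems that m x arcs_symmetric[OF that(3)] no_loops'[OF that(3)]
        by (auto simp: partial_grundy_def)
      show "\<exists>u \<in> insert x W. (v, u) \<in> parcs G \<and> ?c u = i"
        if "v \<in> insert x W" "1 \<le> i \<and> i < ?c v" for v i
      proof (cases "v = x")
        case True
        then show ?thesis using small that x by (metis fun_upd_apply insertCI)
      next
        case False
        then have "\<exists>u \<in> W. (v, u) \<in> parcs G \<and> c u = i"
          using insert.prems that by (auto simp: partial_grundy_def)
        then show ?thesis using x by (metis fun_upd_apply insertCI)
      qed
    qed
    then obtain c' where "partial_grundy G (pverts G) c'" "\<forall>v \<in> insert x W. c' v = ?c v"
      using insert.hyps(3)[OF F] by blast
    then show ?case using x by (intro exI[of _ c']) auto
  qed
qed

text \<open>No color is skipped, because a vertex of the largest color has neighbors of all smaller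
  ones.\<close>

lemma partial_grundy_imp_grundy_coloring:
  assumes "pair_graph G" "partial_grundy G (pverts G) c" "pverts G \<noteq> {}"
  shows "grundy_coloring G (Max (c ` pverts G)) c"
proof -
  interpret pair_graph G by fact
  note pg = assms(2)[unfolded partial_grundy_def]
  let ?k = "Max (c ` pverts G)"
  have fin: "finite (c ` pverts G)" using pair_finite_verts by simp
  have sub: "c ` pverts G \<subseteq> {1..?k}"
    using pg fin by auto
  obtain v where v: "v \<in> pverts G" "c v = ?k"
    using Max_in[OF fin] assms(3) by fastforce
  have "i \<in> c ` pverts G" if "i \<in> {1..?k}" for i
  proof (cases "i = ?k")
    case True
    then show ?thesis using v by force
  next
    case False
    then have "1 \<le> i \<and> i < c v" using that v by auto
    then show ?thesis using pg v by (metis imageI)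
  qed
  then have "c ` pverts G = {1..?k}" using sub by blast
  then show ?thesis
    unfolding grundy_coloring_def proper_coloring_def
  proof (intro conjI)
    show "\<forall>(u, v) \<in> parcs G. c u \<noteq> c v"
      using pg in_arcsD1 in_arcsD2 by blast
  qed (use pg in blast)+
qed

lemma grundy_coloring_imp_partial_grundy:
  assumes "pair_graph G" "grundy_coloring G k c"
  shows "partial_grundy G (pverts G) c"
proof -
  interpret pair_graph G by fact
  show ?thesis
    using assms(2) in_arcsD2
    unfolding grundy_coloring_def partial_grundy_def proper_coloring_def by fastforce
qed

lemma grundy_number_le_imp:
  assumes "pair_graph G" "grundy_number G \<le> b"
  shows "grundy_le G b"
  unfolding grundy_le_def
proof (intro allI impI ballI)
  interpret pair_graph G by fact
  fix W c v assume W: "partial_grundy G W c" "v \<in> W"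
  obtain c' where c': "partial_grundy G (pverts G) c'" "\<forall>v \<in> W. c' v = c v"
    using partial_grundy_extend[OF assms(1) W(1)] by blast
  have v: "v \<in> pverts G" using W by (auto simp: partial_grundy_def)
  let ?K = "{k. \<exists>\<phi>. grundy_coloring G k \<phi>}"
  \<comment> \<open>\<open>Max\<close> is informative only on a finite set; the number of colors is
    bounded by the number of vertices.\<close>
  have "k \<le> card (pverts G)" if k: "k \<in> ?K" for k
  proof -
    obtain \<phi> where "grundy_coloring G k \<phi>" using k by blast
    then have "\<phi> ` pverts G = {1..k}" by (simp add: grundy_coloring_def)
    then show ?thesis using card_image_le[OF pair_finite_verts, of \<phi>] by simp
  qed
  then have "finite ?K" by (meson atMost_iff finite_atMost finite_subset subsetI)
  moreover have "Max (c' ` pverts G) \<in> ?K"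
    using partial_grundy_imp_grundy_coloring[OF assms(1) c'(1)] v by blast
  ultimately have "Max (c' ` pverts G) \<le> grundy_number G"
    unfolding grundy_number_def by (rule Max_ge)
  moreover have "c' v \<le> Max (c' ` pverts G)"
    using v pair_finite_verts by simp
  ultimately show "c v \<le> b" using c'(2) W(2) assms(2) by simp
qed

text \<open>A vertex of a color above \<open>Suc b\<close> has a neighbor of color exactly
  \<open>Suc b\<close>, so excluding that one color excludes all larger ones.\<close>

lemma grundy_leI:
  assumes "pair_graph G"
    and "\<And>c v. partial_grundy G (pverts G) c \<Longrightarrow> v \<in> pverts G \<Longrightarrow> c v \<noteq> Suc b"
  shows "grundy_le G b"
  unfolding grundy_le_def
proof (intro allI impI ballI, rule ccontr)
  fix W c v assume W: "partial_grundy G W c" "v \<in> W" "\<not> c v \<le> b"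
  obtain c' where c': "partial_grundy G (pverts G) c'" "\<forall>v \<in> W. c' v = c v"
    using partial_grundy_extend[OF assms(1) W(1)] by blast
  have v: "v \<in> pverts G" "Suc b \<le> c' v" using W c'(2) by (auto simp: partial_grundy_def)
  have "\<exists>u \<in> pverts G. c' u = Suc b"
  proof (cases "c' v = Suc b")
    case True
    then show ?thesis using v by blast
  next
    case False
    then have "1 \<le> Suc b \<and> Suc b < c' v" using v by simp
    then show ?thesis using c'(1) v unfolding partial_grundy_def by blast
  qed
  then show False using assms(2)[OF c'(1)] by blast
qed

lemma partial_grundy_image:
  assumes "partial_grundy G W c" "inj_on f W" "f ` W \<subseteq> pverts H"
    and "\<And>u v. u \<in> W \<Longrightarrow> v \<in> W \<Longrightarrow> (f u, f v) \<in> parcs H \<longleftrightarrow> (u, v) \<in> parcs G"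
  shows "partial_grundy H (f ` W) (c \<circ> the_inv_into W f)"
  using assms unfolding partial_grundy_def by (simp add: the_inv_into_f_f)

lemma grundy_le_embedding:
  assumes "grundy_le H b" "inj_on f (pverts G)" "f ` pverts G \<subseteq> pverts H"
    and "\<And>u v. u \<in> pverts G \<Longrightarrow> v \<in> pverts G \<Longrightarrow> (f u, f v) \<in> parcs H \<longleftrightarrow> (u, v) \<in> parcs G"
  shows "grundy_le G b"
  unfolding grundy_le_def
proof (intro allI impI ballI)
  fix W c v assume W: "partial_grundy G W c" "v \<in> W"
  then have sub: "W \<subseteq> pverts G" by (simp add: partial_grundy_def)
  have inj: "inj_on f W" using assms(2) sub by (rule inj_on_subset)
  have "partial_grundy H (f ` W) (c \<circ> the_inv_into W f)"
    using assms sub inj by (intro partial_grundy_image[OF W(1)]) blast+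
  then have "(c \<circ> the_inv_into W f) (f v) \<le> b"
    using assms(1) W(2) unfolding grundy_le_def by blast
  then show "c v \<le> b" using inj W(2) by (simp add: the_inv_into_f_f)
qed

text \<open>A triangle forces three colors in every proper coloring, while Grundy colorings stay
  within the bound. So every Grundy coloring has exactly three colors, and the greedy one witnesses
  the chromatic number as well.\<close>

lemma triangle_numbers:
  assumes G: "pair_graph G" and le: "grundy_le G 3"
    and tri: "(x, y) \<in> parcs G" "(y, z) \<in> parcs G" "(x, z) \<in> parcs G"
  shows "chromatic_number G = 3" "grundy_number G = 3"
proof -
  interpret pair_graph G by fact
  have V: "x \<in> pverts G" "y \<in> pverts G" "z \<in> pverts G"
    using tri in_arcsD1 in_arcsD2 by blast+
  have ge: "3 \<le> k" if "proper_coloring G k \<phi>" for k \<phi>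
  proof -
    have "\<phi> x \<noteq> \<phi> y" "\<phi> y \<noteq> \<phi> z" "\<phi> x \<noteq> \<phi> z"
      using that tri unfolding proper_coloring_def by blast+
    then have "card {\<phi> x, \<phi> y, \<phi> z} = 3" by simp
    moreover have "{\<phi> x, \<phi> y, \<phi> z} \<subseteq> {1..k}"
      using that V unfolding proper_coloring_def by blast
    ultimately show ?thesis by (metis card_atLeastAtMost card_mono diff_Suc_1 finite_atLeastAtMost)
  qed
  have le': "k \<le> 3" if "grundy_coloring G k \<phi>" for k \<phi>
  proof -
    have "partial_grundy G (pverts G) \<phi>"
      using grundy_coloring_imp_partial_grundy[OF G that] .
    moreover have "3 \<le> k" using ge that by (auto simp: grundy_coloring_def)
    then have "k \<in> \<phi> ` pverts G"
      using that by (simp add: grundy_coloring_def)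
    ultimately show ?thesis using le unfolding grundy_le_def by blast
  qed
  have "partial_grundy G {} (\<lambda>_. 0)" by (simp add: partial_grundy_def)
  then obtain c where "partial_grundy G (pverts G) c"
    using partial_grundy_extend[OF G] by blast
  then have c: "grundy_coloring G (Max (c ` pverts G)) c"
    using partial_grundy_imp_grundy_coloring[OF G] V by blast
  then have "Max (c ` pverts G) = 3"
    using ge le' by (metis antisym grundy_coloring_def)
  then have c3: "grundy_coloring G 3 c" using c by simp
  then have "proper_coloring G 3 c" by (simp add: grundy_coloring_def)
  then show "chromatic_number G = 3"
    unfolding chromatic_number_def using ge by (intro Least_equality) auto
  have "k = 3" if "grundy_coloring G k \<phi>" for k \<phi>
    using ge le' that by (metis antisym grundy_coloring_def)
  then have "{k. \<exists>\<phi>. grundy_coloring G k \<phi>} = {3}" using c3 by blast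
  then show "grundy_number G = 3" by (simp add: grundy_number_def)
qed

section \<open>The lower bound for the number of vertices\<close>

lemma complete_coloring_nbr:
  assumes "complete_coloring G k \<phi>" "i \<in> {1..k}" "j \<in> {1..k}" "i \<noteq> j"
    and "\<And>u. u \<in> pverts G \<Longrightarrow> \<phi> u = i \<Longrightarrow> u = v" "pair_graph G"
  shows "\<exists>u. (v, u) \<in> parcs G \<and> \<phi> u = j"
proof -
  interpret pair_graph G by fact
  obtain x u where "(x, u) \<in> parcs G" "\<phi> x = i" "\<phi> u = j"
    using assms(1-4) unfolding complete_coloring_def by blast
  then show ?thesis using assms(5) in_arcsD1 by blast
qed

text \<open>The four classes receive the colors 1 to 4 in the listed order and all other vertices
  stay uncolored. A Grundy coloring then demands exactly that every vertex of a class sees all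
  earlier classes.\<close>

lemma four_color_classes:
  assumes G: "pair_graph G" and le: "grundy_le G 3" and \<phi>: "complete_coloring G k \<phi>"
    and m: "distinct [m1, m2, m3, m4]" "m4 \<in> {1..k}"
    and nbr: "\<And>v. v \<in> pverts G \<Longrightarrow> \<phi> v = m2 \<Longrightarrow> \<exists>u. (v, u) \<in> parcs G \<and> \<phi> u = m1"
      "\<And>v i. v \<in> pverts G \<Longrightarrow> \<phi> v = m3 \<Longrightarrow> i \<in> {m1, m2} \<Longrightarrow> \<exists>u. (v, u) \<in> parcs G \<and> \<phi> u = i"
      "\<And>v i. v \<in> pverts G \<Longrightarrow> \<phi> v = m4 \<Longrightarrow> i \<in> {m1, m2, m3} \<Longrightarrow> \<exists>u. (v, u) \<in> parcs G \<and> \<phi> u = i"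
  shows False
proof -
  interpret pair_graph G by fact
  define r :: "nat \<Rightarrow> nat" where
    "r i = (if i = m1 then 1 else if i = m2 then 2 else if i = m3 then 3 else 4)" for i
  have r: "r m1 = 1" "r m2 = 2" "r m3 = 3" "r m4 = 4" using m(1) by (auto simp: r_def)
  have inj: "inj_on r {m1, m2, m3, m4}" using r by (auto simp: inj_on_def)
  let ?W = "{v \<in> pverts G. \<phi> v \<in> {m1, m2, m3, m4}}"
  have proper: "\<phi> u \<noteq> \<phi> v" if "(u, v) \<in> parcs G" for u v
    using \<phi> that by (auto simp: complete_coloring_def proper_coloring_def)
  have desc: "\<exists>u \<in> ?W. (v, u) \<in> parcs G \<and> r (\<phi> u) = i"
    if v: "v \<in> ?W" and i: "1 \<le> i" "i < r (\<phi> v)" for v i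
  proof -
    have "\<exists>j \<in> {m1, m2, m3}. r j = i \<and> (\<exists>u. (v, u) \<in> parcs G \<and> \<phi> u = j)"
    proof -
      consider "\<phi> v = m1" | "\<phi> v = m2" | "\<phi> v = m3" | "\<phi> v = m4"
        using v by blast
      then show ?thesis
      proof cases
        case 1
        then show ?thesis using i r(1) by simp
      next
        case 2
        then have "i = 1" using i r(2) by simp
        then show ?thesis using nbr(1)[of v] v 2 r(1) by simp
      next
        case 3
        then have "i = 1 \<or> i = 2" using i r(3) by auto
        then show ?thesis
          using nbr(2)[of v m1] nbr(2)[of v m2] v 3 r(1,2) by auto
      next
        case 4
        then have "i = 1 \<or> i = 2 \<or> i = 3" using i r(4) by auto
        then show ?thesis
          using nbr(3)[of v m1] nbr(3)[of v m2] nbr(3)[of v m3] v 4 r(1-3) by auto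
      qed
    qed
    then obtain u where u: "(v, u) \<in> parcs G" "\<phi> u \<in> {m1, m2, m3}" "r (\<phi> u) = i"
      by blast
    moreover have "u \<in> pverts G" using u(1) by (rule in_arcsD2)
    ultimately show ?thesis by blast
  qed
  have "partial_grundy G ?W (r \<circ> \<phi>)"
    unfolding partial_grundy_def
  proof (intro conjI ballI allI impI)
    show "(r \<circ> \<phi>) u \<noteq> (r \<circ> \<phi>) v" if "u \<in> ?W" "v \<in> ?W" "(u, v) \<in> parcs G" for u v
      using that proper[OF that(3)] inj by (auto simp: inj_on_def)
    show "\<exists>u \<in> ?W. (v, u) \<in> parcs G \<and> (r \<circ> \<phi>) u = i"
      if "v \<in> ?W" "1 \<le> i \<and> i < (r \<circ> \<phi>) v" for v i
      using desc[of v i] that by simp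
  qed (auto simp: r_def)
  moreover obtain v where "v \<in> pverts G" "\<phi> v = m4"
    using \<phi> m(2) unfolding complete_coloring_def by (metis imageE)
  ultimately have "(r \<circ> \<phi>) v \<le> 3" using le unfolding grundy_le_def by blast
  then show False using \<open>\<phi> v = m4\<close> r by simp
qed

lemma singleton_color_classes:
  assumes G: "pair_graph G" and le: "grundy_le G 3" and \<phi>: "complete_coloring G k \<phi>" and k: "4 \<le> k"
  shows "card {i \<in> {1..k}. card {v \<in> pverts G. \<phi> v = i} = 1} \<le> 2" (is "card ?S \<le> 2")
proof (rule ccontr)
  assume "\<not> card ?S \<le> 2"
  then have "3 \<le> card ?S" by simp
  then obtain T where T: "T \<subseteq> ?S" "card T = 3"
    using obtain_subset_with_card_n[of 3 ?S] by blast
  then obtain a b c where "T = {a, b, c}" "a \<noteq> b" "b \<noteq> c" "a \<noteq> c"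
    unfolding card_3_iff by blast
  then have abc: "a \<in> ?S" "b \<in> ?S" "c \<in> ?S" and ne: "a \<noteq> b" "b \<noteq> c" "a \<noteq> c"
    using T(1) by blast+
  then have k_abc: "a \<in> {1..k}" "b \<in> {1..k}" "c \<in> {1..k}" by blast+
  have "\<not> {1..k} \<subseteq> {a, b, c}"
  proof
    assume "{1..k} \<subseteq> {a, b, c}"
    then have "card {1..k} \<le> card {a, b, c}" by (intro card_mono) auto
    also have "\<dots> \<le> 3" by (simp add: card_insert_if)
    finally show False using k by simp
  qed
  then obtain d where d: "d \<in> {1..k}" "d \<notin> {a, b, c}" by blast
  have nbr: "\<exists>u. (v, u) \<in> parcs G \<and> \<phi> u = j"
    if "i \<in> ?S" "v \<in> pverts G" "\<phi> v = i" "j \<in> {1..k}" "j \<noteq> i" for i v j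
  proof (rule complete_coloring_nbr[OF \<phi>, of i])
    fix u assume u: "u \<in> pverts G" "\<phi> u = i"
    have "card {v \<in> pverts G. \<phi> v = i} = 1" using that(1) by blast
    then obtain w where "{v \<in> pverts G. \<phi> v = i} = {w}" by (rule card_1_singletonE)
    then have "u \<in> {w}" "v \<in> {w}" using u that(2,3) by blast+
    then show "u = v" by simp
  qed (use that G in blast)+
  show False
  proof (rule four_color_classes[OF G le \<phi>])
    \<comment> \<open>The class \<open>d\<close>, of unknown size, gets color 1, where nothing is
      required of its vertices.\<close>
    show "distinct [d, a, b, c]" using ne d(2) by simp
    show "c \<in> {1..k}" by (fact k_abc)
    show "\<exists>u. (v, u) \<in> parcs G \<and> \<phi> u = d" if "v \<in> pverts G" "\<phi> v = a" for v
      using nbr[OF abc(1) that d(1)] d(2) by blast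
    show "\<exists>u. (v, u) \<in> parcs G \<and> \<phi> u = i"
      if "v \<in> pverts G" "\<phi> v = b" "i \<in> {d, a}" for v i
      by (rule nbr[OF abc(2) that(1,2)]) (use that(3) d ne k_abc in blast)+
    show "\<exists>u. (v, u) \<in> parcs G \<and> \<phi> u = i"
      if "v \<in> pverts G" "\<phi> v = c" "i \<in> {d, a, b}" for v i
      by (rule nbr[OF abc(3) that(1,2)]) (use that(3) d ne k_abc in blast)+
  qed
qed

text \<open>Adding 1 for every singleton class makes each class count at least 2, so 2k is at most
  the number of vertices plus the number of singletons. With 2k - 2 vertices all these estimates are
  tight.\<close>

lemma complete_coloring_card:
  assumes G: "pair_graph G" and le: "grundy_le G 3" and \<phi>: "complete_coloring G k \<phi>" and k: "4 \<le> k"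
  shows "2 * k - 2 \<le> card (pverts G)"
    and "card (pverts G) = 2 * k - 2 \<Longrightarrow>
      \<exists>p \<in> {1..k}. \<exists>q \<in> {1..k}. p \<noteq> q \<and> card {v \<in> pverts G. \<phi> v = p} = 1 \<and>
        card {v \<in> pverts G. \<phi> v = q} = 1 \<and>
        (\<forall>i \<in> {1..k} - {p, q}. card {v \<in> pverts G. \<phi> v = i} = 2)"
proof -
  interpret pair_graph G by fact
  define n where "n i = card {v \<in> pverts G. \<phi> v = i}" for i
  let ?S = "{i \<in> {1..k}. n i = 1}"
  have S: "card ?S \<le> 2" using singleton_color_classes[OF assms] by (simp add: n_def)
  define g where "g i = n i + (if n i = 1 then 1 else 0)" for i
  have img: "\<phi> ` pverts G = {1..k}" using \<phi> by (simp add: complete_coloring_def)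
  have "card (pverts G) = (\<Sum>v \<in> pverts G. 1)" by simp
  also have "\<dots> = (\<Sum>i \<in> \<phi> ` pverts G. \<Sum>v | v \<in> pverts G \<and> \<phi> v = i. 1)"
    using pair_finite_verts by (rule sum.image_gen)
  also have "\<dots> = (\<Sum>i \<in> {1..k}. n i)" by (simp add: img n_def)
  finally have V: "card (pverts G) = (\<Sum>i \<in> {1..k}. n i)" .
  have "(\<Sum>i \<in> {1..k}. if n i = 1 then 1 else 0) = card ?S"
    by (simp add: sum.If_cases Int_def)
  then have sum_g: "(\<Sum>i \<in> {1..k}. g i) = card (pverts G) + card ?S"
    by (simp add: g_def V sum.distrib)
  have g: "2 \<le> g i" if i: "i \<in> {1..k}" for i
  proof -
    obtain v where "v \<in> pverts G" "\<phi> v = i" using i img by (metis imageE)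
    then have "n i \<noteq> 0" using pair_finite_verts by (auto simp: n_def)
    then show ?thesis by (simp add: g_def)
  qed
  have "(\<Sum>i \<in> {1..k}. 2) \<le> (\<Sum>i \<in> {1..k}. g i)" using g by (rule sum_mono)
  then have le_g: "2 * k \<le> card (pverts G) + card ?S" using sum_g by simp
  then show "2 * k - 2 \<le> card (pverts G)" using S by linarith
  assume eq: "card (pverts G) = 2 * k - 2"
  then have S2: "card ?S = 2" using S le_g k by linarith
  then have "(\<Sum>i \<in> {1..k}. 2) = (\<Sum>i \<in> {1..k}. g i)" using sum_g eq k by simp
  then have g2: "g i = 2" if "i \<in> {1..k}" for i
    using sum_mono_inv[of "\<lambda>_. 2" "{1..k}" g i] g that by auto
  obtain p q where pq: "?S = {p, q}" "p \<noteq> q" using S2 by (auto simp: card_2_iff)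
  have "n i = 2" if "i \<in> {1..k} - {p, q}" for i
  proof -
    have "n i \<noteq> 1" using that pq by blast
    then show ?thesis using g2[of i] that by (simp add: g_def)
  qed
  moreover have "p \<in> {1..k}" "q \<in> {1..k}" "n p = 1" "n q = 1" using pq by blast+
  ultimately show "\<exists>p \<in> {1..k}. \<exists>q \<in> {1..k}. p \<noteq> q \<and> card {v \<in> pverts G. \<phi> v = p} = 1 \<and>
        card {v \<in> pverts G. \<phi> v = q} = 1 \<and>
        (\<forall>i \<in> {1..k} - {p, q}. card {v \<in> pverts G. \<phi> v = i} = 2)"
    using pq(2) unfolding n_def by blast
qed

section \<open>Two hubs and pairs of legs\<close>

datatype vertex = Hub bool | Leg nat bool

text \<open>
  How a pair of legs is attached to the two hubs, up to exchanging the legs: leg \<open>False\<close> is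
  adjacent to both hubs except for \<open>Split\<close>, where each leg is adjacent to the hub of the same sign;
  \<open>Ear r\<close> joins the other leg to the hub \<open>r\<close> only.
\<close>

datatype link = Split | Pendant | Ear bool | Full

fun hub_adj :: "link \<Rightarrow> bool \<Rightarrow> bool \<Rightarrow> bool" where
  "hub_adj Split p q \<longleftrightarrow> p = q"
| "hub_adj Pendant p q \<longleftrightarrow> \<not> q"
| "hub_adj (Ear r) p q \<longleftrightarrow> (q \<longrightarrow> p = r)"
| "hub_adj Full p q \<longleftrightarrow> True"

text \<open>
  \<open>s i j\<close> is the end in pair \<open>i\<close> of the unique edge between the pairs \<open>i\<close> and \<open>j\<close>.
\<close>

fun adj :: "(nat \<Rightarrow> link) \<Rightarrow> (nat \<Rightarrow> nat \<Rightarrow> bool) \<Rightarrow> vertex \<Rightarrow> vertex \<Rightarrow> bool" where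
  "adj \<tau> s (Hub p) (Hub q) \<longleftrightarrow> p \<noteq> q"
| "adj \<tau> s (Hub p) (Leg i q) \<longleftrightarrow> hub_adj (\<tau> i) p q"
| "adj \<tau> s (Leg i q) (Hub p) \<longleftrightarrow> hub_adj (\<tau> i) p q"
| "adj \<tau> s (Leg i p) (Leg j q) \<longleftrightarrow> i \<noteq> j \<and> s i j = p \<and> s j i = q"

definition vset :: "nat \<Rightarrow> vertex set" where
  "vset k = range Hub \<union> (\<Union>i<k. range (Leg i))"

definition frame :: "nat \<Rightarrow> (nat \<Rightarrow> link) \<Rightarrow> (nat \<Rightarrow> nat \<Rightarrow> bool) \<Rightarrow> vertex pair_pre_digraph" where
  "frame k \<tau> s = \<lparr>pverts = vset k, parcs = {(u, v) \<in> vset k \<times> vset k. adj \<tau> s u v}\<rparr>"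

lemma in_vset [simp]: "Hub p \<in> vset k" "Leg i q \<in> vset k \<longleftrightarrow> i < k"
  by (auto simp: vset_def)

lemma pverts_frame [simp]: "pverts (frame k \<tau> s) = vset k"
  by (simp add: frame_def)

lemma parcs_frame [simp]:
  "(u, v) \<in> parcs (frame k \<tau> s) \<longleftrightarrow> u \<in> vset k \<and> v \<in> vset k \<and> adj \<tau> s u v"
  by (auto simp: frame_def)

lemma adj_sym: "adj \<tau> s u v \<longleftrightarrow> adj \<tau> s v u"
  by (cases u; cases v) auto

lemma finite_vset [simp]: "finite (vset k)"
  by (simp add: vset_def)

lemma card_vset: "card (vset k) = 2 * k + 2"
proof (induction k)
  case 0
  have "vset 0 = {Hub False, Hub True}" by (auto simp: vset_def UNIV_bool)
  then show ?case by simp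
next
  case (Suc k)
  have "vset (Suc k) = insert (Leg k False) (insert (Leg k True) (vset k))"
    by (auto simp: vset_def lessThan_Suc UNIV_bool)
  then show ?case using Suc by simp
qed

lemma pair_graph_frame: "pair_graph (frame k \<tau> s)"
proof -
  have "\<not> adj \<tau> s v v" for v by (cases v) auto
  then show ?thesis
    unfolding pair_graph_iff by (auto simp: frame_def sym_def irrefl_def adj_sym)
qed

text \<open>\<open>q \<noteq> r\<close> exchanges the two legs exactly when \<open>r\<close> holds.
  If some leg sees both hubs it is renamed \<open>False\<close>, and the hubs seen by the other leg
  select the link. Otherwise the hubs see different single legs, which is \<open>Split\<close> after
  a suitable exchange.\<close>

lemma hub_adj_normal_form:
  fixes P :: "bool \<Rightarrow> bool \<Rightarrow> bool"
  assumes "\<And>p. \<exists>q. P p q"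
  shows "\<exists>t r. \<forall>p q. P p (q \<noteq> r) \<longleftrightarrow> hub_adj t p q"
proof -
  have P: "P p False \<or> P p True" for p using assms[of p] by (metis (full_types))
  show ?thesis
  proof (cases "\<exists>r. \<forall>p. P p r")
    case True
    then obtain r where r: "\<forall>p. P p r" by blast
    have "\<forall>p q. P p (q \<noteq> r) \<longleftrightarrow> hub_adj t p q"
      if "t = (if P False (\<not> r) \<and> P True (\<not> r) then Full
         else if P False (\<not> r) then Ear False else if P True (\<not> r) then Ear True else Pendant)" for t
      using that r by (auto simp: all_bool_eq)
    then show ?thesis by blast
  next
    case False
    then have N: "\<not> P False r \<or> \<not> P True r" for r by (metis (full_types))
    obtain r where r: "r \<longleftrightarrow> P False True" by blast
    have "\<forall>p q. P p (q \<noteq> r) \<longleftrightarrow> hub_adj Split p q"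
      using P[of False] P[of True] N[of False] N[of True] r by (cases r) (simp_all add: all_bool_eq)
    then show ?thesis by blast
  qed
qed

text \<open>A 2 by 2 table with an empty row, an empty column and some entry has a single entry; its
  row is \<open>True\<close> iff row \<open>True\<close> is occupied, and likewise for
  columns.\<close>

lemma unique_true_entry:
  fixes P :: "bool \<Rightarrow> bool \<Rightarrow> bool"
  assumes "\<exists>p. \<forall>q. \<not> P p q" "\<exists>q. \<forall>p. \<not> P p q" "\<exists>p q. P p q"
  shows "P p q \<longleftrightarrow> (\<exists>q. P True q) = p \<and> (\<exists>p. P p True) = q"
  using assms by (cases p; cases q) (auto simp: all_bool_eq ex_bool_eq)

text \<open>In each pair the names of the legs are fixed by the attachment to the hubs first,
  because renaming them alters the ends recorded in \<open>s\<close>. The edges between pairs are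
  read off afterwards.\<close>

lemma exists_frame:
  assumes G: "pair_graph G" and le: "grundy_le G 3" and \<phi>: "complete_coloring G h \<phi>"
    and h: "4 \<le> h" and card: "card (pverts G) = 2 * h - 2"
  shows "\<exists>\<tau> s. isomorphic (frame (h - 2) \<tau> s) G"
proof -
  interpret pair_graph G by fact
  let ?C = "\<lambda>i. {v \<in> pverts G. \<phi> v = i}"
  obtain c d where cd: "c \<in> {1..h}" "d \<in> {1..h}" "c \<noteq> d" "card (?C c) = 1" "card (?C d) = 1"
    and two: "\<And>i. i \<in> {1..h} - {c, d} \<Longrightarrow> card (?C i) = 2"
    using complete_coloring_card(2)[OF G le \<phi> h card] by blast
  have img: "\<phi> ` pverts G = {1..h}" and proper: "\<And>u v. (u, v) \<in> parcs G \<Longrightarrow> \<phi> u \<noteq> \<phi> v"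
    using \<phi> by (auto simp: complete_coloring_def proper_coloring_def)
  obtain a b where ab: "?C c = {a}" "?C d = {b}"
    using cd by (auto simp: card_1_singleton_iff)
  define hc where "hc p = (if p then d else c)" for p
  define hub where "hub p = (if p then b else a)" for p
  have hc: "hc p \<in> {1..h}" "?C (hc p) = {hub p}" for p using cd ab by (auto simp: hc_def hub_def)
  have hubD: "v = hub p" if "v \<in> pverts G" "\<phi> v = hc p" for v p
    using hc(2)[of p] that by blast
  have hubV: "hub p \<in> pverts G" "\<phi> (hub p) = hc p" for p
    using hc(2)[of p] by blast+
  have hub_nbr: "\<exists>u. (hub p, u) \<in> parcs G \<and> \<phi> u = j" if "j \<in> {1..h}" "j \<noteq> hc p" for j p
    using complete_coloring_nbr[OF \<phi> hc(1), of j p "hub p"] that hubD G by metis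
  let ?R = "{1..h} - {c, d}"
  have hcR: "hc p \<notin> ?R" for p by (auto simp: hc_def)
  have "card ?R = h - 2" using cd by (simp add: card_Diff_subset)
  then obtain g where g: "bij_betw g {..<h - 2} ?R"
    by (metis card_lessThan finite_Diff finite_atLeastAtMost finite_lessThan finite_same_card_bij)
  have gR: "g i \<in> ?R" if "i < h - 2" for i using g that by (meson bij_betwE lessThan_iff)
  have "\<exists>t e. bij_betw e UNIV (?C j) \<and> (\<forall>p q. (hub p, e q) \<in> parcs G \<longleftrightarrow> hub_adj t p q)"
    if j: "j \<in> ?R" for j
  proof -
    obtain x y where xy: "?C j = {x, y}" "x \<noteq> y"
      using two[OF j] unfolding card_2_iff by blast
    define e where "e q = (if q then y else x)" for q
    have e: "?C j = range e" "inj e"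
      using xy by (auto simp: e_def inj_def UNIV_bool)
    have "\<exists>q. (hub p, e q) \<in> parcs G" for p
    proof -
      have "j \<in> {1..h}" "j \<noteq> hc p" using j hcR by blast+
      then obtain u where u: "(hub p, u) \<in> parcs G" "\<phi> u = j"
        using hub_nbr by blast
      then have "u \<in> range e" using in_arcsD2 unfolding e(1)[symmetric] by blast
      then obtain q where "u = e q" by blast
      then show ?thesis using u(1) by blast
    qed
    then obtain t r where tr: "\<forall>p q. (hub p, e (q \<noteq> r)) \<in> parcs G \<longleftrightarrow> hub_adj t p q"
      using hub_adj_normal_form[of "\<lambda>p q. (hub p, e q) \<in> parcs G"] by blast
    have "bij (\<lambda>q. q \<noteq> r)" by (rule involuntory_imp_bij) auto
    moreover have "bij_betw e UNIV (?C j)" using e by (simp add: bij_betw_def)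
    ultimately have "bij_betw (e \<circ> (\<lambda>q. q \<noteq> r)) UNIV (?C j)" by (rule bij_betw_trans)
    then show ?thesis using tr by (intro exI[of _ t] exI[of _ "e \<circ> (\<lambda>q. q \<noteq> r)"]) simp
  qed
  then have "\<forall>i. \<exists>te. i < h - 2 \<longrightarrow> bij_betw (snd te) UNIV (?C (g i)) \<and>
      (\<forall>p q. (hub p, snd te q) \<in> parcs G \<longleftrightarrow> hub_adj (fst te) p q)"
    using gR by simp
  then obtain te where te: "\<And>i. i < h - 2 \<Longrightarrow> bij_betw (snd (te i)) UNIV (?C (g i)) \<and>
      (\<forall>p q. (hub p, snd (te i) q) \<in> parcs G \<longleftrightarrow> hub_adj (fst (te i)) p q)"
    unfolding choice_iff by blast
  define \<tau> e where "\<tau> i = fst (te i)" and "e i = snd (te i)" for i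
  have e: "bij_betw (e i) UNIV (?C (g i))"
    and \<tau>: "(hub p, e i q) \<in> parcs G \<longleftrightarrow> hub_adj (\<tau> i) p q" if "i < h - 2" for i p q
    using te[OF that] by (simp_all add: \<tau>_def e_def)
  have eV: "e i q \<in> pverts G" "\<phi> (e i q) = g i" if "i < h - 2" for i q
    using bij_betwE[OF e[OF that]] by blast+
  have eD: "\<exists>q. v = e i q" if "i < h - 2" "v \<in> pverts G" "\<phi> v = g i" for i v
    using e[OF that(1)] that(2,3) by (auto simp: bij_betw_def)
  define s where "s i j = (\<exists>q. (e i True, e j q) \<in> parcs G)" for i j
  have legs: "(e i p, e j q) \<in> parcs G \<longleftrightarrow> s i j = p \<and> s j i = q"
    if i: "i < h - 2" and j: "j < h - 2" and ij: "i \<noteq> j" for i j p q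
  proof -
    have g_ne: "g i \<noteq> g j"
      using g ij i j by (metis bij_betw_def inj_onD lessThan_iff)
    have no_nbr: "\<exists>p. \<forall>q. (e i p, e j q) \<notin> parcs G"
      if i: "i < h - 2" and j: "j < h - 2" and g_ne: "g i \<noteq> g j" for i j
    proof (rule ccontr)
      assume neg: "\<not> ?thesis"
      show False
      proof (rule four_color_classes[OF G le \<phi>])
        show "distinct [g j, g i, c, d]"
          using g_ne gR[OF i] gR[OF j] cd(3) by auto
        show "d \<in> {1..h}" by (fact cd(2))
        show "\<exists>u. (v, u) \<in> parcs G \<and> \<phi> u = g j" if v: "v \<in> pverts G" "\<phi> v = g i" for v
        proof -
          obtain p where "v = e i p" using eD[OF i v] by blast
          then show ?thesis using neg eV[OF j] by blast
        qed
        show "\<exists>u. (v, u) \<in> parcs G \<and> \<phi> u = l"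
          if "v \<in> pverts G" "\<phi> v = c" "l \<in> {g j, g i}" for v l
        proof -
          have "v = hub False" using hubD[of v False] that by (simp add: hc_def)
          then show ?thesis
            using hub_nbr[of l False] that(3) gR[OF i] gR[OF j] by (auto simp: hc_def)
        qed
        show "\<exists>u. (v, u) \<in> parcs G \<and> \<phi> u = l"
          if "v \<in> pverts G" "\<phi> v = d" "l \<in> {g j, g i, c}" for v l
        proof -
          have "v = hub True" using hubD[of v True] that by (simp add: hc_def)
          then show ?thesis
            using hub_nbr[of l True] that(3) gR[OF i] gR[OF j] cd by (auto simp: hc_def)
        qed
      qed
    qed
    have sym: "(e i p, e j q) \<in> parcs G \<longleftrightarrow> (e j q, e i p) \<in> parcs G" for p q
      using arcs_symmetric by blast
    have "g i \<in> {1..h}" "g j \<in> {1..h}" using gR[OF i] gR[OF j] by blast+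
    then obtain u v where uv: "(u, v) \<in> parcs G" "\<phi> u = g i" "\<phi> v = g j"
      using \<phi> g_ne unfolding complete_coloring_def by blast
    then obtain p' q' where "u = e i p'" "v = e j q'"
      using eD[OF i in_arcsD1[OF uv(1)]] eD[OF j in_arcsD2[OF uv(1)]] by blast
    then have ex: "\<exists>p q. (e i p, e j q) \<in> parcs G" using uv(1) by blast
    \<comment> \<open>The same exclusion with the two pairs exchanged yields an empty column;
      together with the edge demanded by completeness only one entry remains.\<close>
    have col: "\<exists>q. \<forall>p. (e i p, e j q) \<notin> parcs G"
      using no_nbr[OF j i] g_ne sym by metis
    show ?thesis
      using unique_true_entry[of "\<lambda>p q. (e i p, e j q) \<in> parcs G" p q, OF no_nbr[OF i j g_ne] col ex]
      by (simp add: s_def sym)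
  qed
  define F where "F v = (case v of Hub p \<Rightarrow> hub p | Leg i q \<Rightarrow> e i q)" for v
  have F [simp]: "F (Hub p) = hub p" "F (Leg i q) = e i q" for p i q by (simp_all add: F_def)
  have "inj_on F (vset (h - 2))"
  proof (rule inj_onI)
    fix u v assume uv: "u \<in> vset (h - 2)" "v \<in> vset (h - 2)" "F u = F v"
    have hub_leg: "hub p \<noteq> e i q" if "i < h - 2" for p i q
      using hubV(2)[of p] eV(2)[OF that, of q] gR[OF that] hcR[of p] by metis
    show "u = v"
    proof (cases u; cases v)
      fix p q assume l: "u = Hub p" "v = Hub q"
      then have "hub p = hub q" using uv(3) by simp
      then have "hc p = hc q" using hubV(2)[of p] hubV(2)[of q] by simp
      then have "p = q" using cd(3) by (auto simp: hc_def split: if_splits)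
      then show ?thesis using l by simp
    next
      fix p i q assume "u = Hub p" "v = Leg i q"
      then show ?thesis using uv hub_leg by simp
    next
      fix p i q assume "u = Leg i q" "v = Hub p"
      then show ?thesis using uv hub_leg by (metis F in_vset(2))
    next
      fix i p j q assume l: "u = Leg i p" "v = Leg j q"
      then have ij: "i < h - 2" "j < h - 2" using uv by auto
      have eq: "e i p = e j q" using l uv by simp
      then have "g i = g j" using eV(2)[OF ij(1), of p] eV(2)[OF ij(2), of q] by simp
      then have "i = j" using g ij by (metis bij_betw_def inj_onD lessThan_iff)
      moreover have "inj (e i)" using e[OF ij(1)] by (simp add: bij_betw_def)
      ultimately show ?thesis using eq l by (simp add: inj_eq)
    qed
  qed
  moreover have "F ` vset (h - 2) = pverts G"
  proof (intro equalityI subsetI)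
    fix v assume "v \<in> F ` vset (h - 2)"
    then obtain u where u: "u \<in> vset (h - 2)" "v = F u" by blast
    then show "v \<in> pverts G" using hubV eV by (cases u) auto
  next
    fix v assume v: "v \<in> pverts G"
    then have "\<phi> v \<in> {1..h}" using img by blast
    then consider "\<phi> v = hc False" | "\<phi> v = hc True" | "\<phi> v \<in> ?R" by (auto simp: hc_def)
    then show "v \<in> F ` vset (h - 2)"
    proof cases
      case 1
      then show ?thesis using hubD[OF v] F(1) by (metis image_eqI in_vset(1))
    next
      case 2
      then show ?thesis using hubD[OF v] F(1) by (metis image_eqI in_vset(1))
    next
      case 3
      then obtain i where i: "i < h - 2" "\<phi> v = g i"
        using g by (metis bij_betw_imp_surj_on imageE lessThan_iff)
      then obtain q where "v = e i q" using eD v by blast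
      then show ?thesis using i F(2) by (metis image_eqI in_vset(2))
    qed
  qed
  moreover have "(F u, F v) \<in> parcs G \<longleftrightarrow> (u, v) \<in> parcs (frame (h - 2) \<tau> s)"
    if uv: "u \<in> vset (h - 2)" "v \<in> vset (h - 2)" for u v
  proof -
    have hubs: "(hub p, hub q) \<in> parcs G \<longleftrightarrow> p \<noteq> q" for p q
    proof
      assume "(hub p, hub q) \<in> parcs G"
      then show "p \<noteq> q" using no_loops' by blast
    next
      assume "p \<noteq> q"
      then have "hc q \<in> {1..h}" "hc q \<noteq> hc p" using hc(1) cd(3) by (auto simp: hc_def)
      then obtain u where "(hub p, u) \<in> parcs G" "\<phi> u = hc q" using hub_nbr by blast
      then show "(hub p, hub q) \<in> parcs G" using hubD in_arcsD2 by blast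
    qed
    show ?thesis
    proof (cases u; cases v)
      fix i p j q assume l: "u = Leg i p" "v = Leg j q"
      show ?thesis
      proof (cases "i = j")
        case True
        then have "\<phi> (e i p) = \<phi> (e j q)" using l uv eV(2) by simp
        then have "(e i p, e j q) \<notin> parcs G" using proper by blast
        then show ?thesis using l True by simp
      next
        case False
        then show ?thesis using l uv legs by simp
      qed
    next
      fix i q p assume l: "u = Leg i q" "v = Hub p"
      have "(e i q, hub p) \<in> parcs G \<longleftrightarrow> (hub p, e i q) \<in> parcs G"
        by (rule iffI; erule arcs_symmetric)
      then show ?thesis using l uv \<tau>[of i p q] by simp
    qed (use uv hubs \<tau> in auto)
  qed
  ultimately have "isomorphic (frame (h - 2) \<tau> s) G"
    unfolding isomorphic_def bij_betw_def pverts_frame by blast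
  then show ?thesis by blast
qed

section \<open>Forbidden configurations\<close>

text \<open>
  The lists are the color classes of a partial Grundy coloring, from the highest color down to color 1.
  They need not be required to be disjoint: a common vertex of two classes would have a neighbor in
  its own class.
\<close>

fun layered :: "('a \<Rightarrow> 'a \<Rightarrow> bool) \<Rightarrow> 'a list list \<Rightarrow> bool" where
  "layered A [] \<longleftrightarrow> True"
| "layered A (C # Cs) \<longleftrightarrow> layered A Cs \<and>
     list_all (\<lambda>v. \<not> list_ex (A v) C \<and> list_all (list_ex (A v)) Cs) C"

text \<open>A new class goes on top with color \<open>Suc (length Cs)\<close>. The clauses saying
  that each list is monochromatic and that each color belongs to a list carry the induction: they
  turn a neighbor in every list into a neighbor of every smaller color. The padding
  \<open>[[]]\<close> gives \<open>hd\<close> a value when there are no classes.\<close>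

lemma layered_imp_partial_grundy:
  assumes G: "pair_graph G" and "layered (\<lambda>u v. (u, v) \<in> parcs G) Cs"
    and "set (concat Cs) \<subseteq> pverts G"
  shows "\<exists>c. partial_grundy G (set (concat Cs)) c \<and> (\<forall>v \<in> set (concat Cs). c v \<le> length Cs) \<and>
    (\<forall>D \<in> set Cs. \<exists>i. \<forall>v \<in> set D. c v = i) \<and>
    (\<forall>i \<in> {1..length Cs}. \<exists>D \<in> set Cs. \<forall>v \<in> set D. c v = i) \<and>
    (\<forall>v \<in> set (hd (Cs @ [[]])). c v = length Cs)"
  using assms(2,3)
proof (induction Cs)
  case Nil
  then show ?case by (simp add: partial_grundy_def)
next
  case (Cons C Cs)
  interpret pair_graph G by fact
  let ?W = "set (concat Cs)"
  have "layered (\<lambda>u v. (u, v) \<in> parcs G) Cs" "?W \<subseteq> pverts G" using Cons.prems by auto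
  then obtain c where c: "partial_grundy G ?W c" and le: "\<forall>v \<in> ?W. c v \<le> length Cs"
    and mono: "\<forall>D \<in> set Cs. \<exists>i. \<forall>v \<in> set D. c v = i"
    and ex: "\<forall>i \<in> {1..length Cs}. \<exists>D \<in> set Cs. \<forall>v \<in> set D. c v = i"
    using Cons.IH by blast
  have indep: "(v, u) \<notin> parcs G" if "v \<in> set C" "u \<in> set C" for u v
    using Cons.prems(1) that by (auto simp: list_all_iff list_ex_iff)
  have nbr: "\<exists>u \<in> set D. (v, u) \<in> parcs G" if "v \<in> set C" "D \<in> set Cs" for v D
    using Cons.prems(1) that by (auto simp: list_all_iff list_ex_iff)
  have disj: "v \<notin> ?W" if v: "v \<in> set C" for v
  proof
    assume "v \<in> ?W"
    then obtain D where D: "D \<in> set Cs" "v \<in> set D" by auto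
    then obtain u where u: "u \<in> set D" "(v, u) \<in> parcs G" using nbr v by blast
    then have "c u = c v" using mono D by metis
    moreover have "u \<in> ?W" "v \<in> ?W" using D u by auto
    ultimately show False using c u(2) unfolding partial_grundy_def by metis
  qed
  define c' where "c' v = (if v \<in> set C then Suc (length Cs) else c v)" for v
  have old: "c' v = c v" if "v \<in> ?W" for v using disj that by (auto simp: c'_def)
  have new: "c' v = Suc (length Cs)" if "v \<in> set C" for v using that by (simp add: c'_def)
  have W: "set (concat (C # Cs)) = set C \<union> ?W" by simp
  have "partial_grundy G (set C \<union> ?W) c'"
    unfolding partial_grundy_def
  proof (intro conjI ballI allI impI)
    show "set C \<union> ?W \<subseteq> pverts G" using Cons.prems(2) by simp
    show "1 \<le> c' v" if v: "v \<in> set C \<union> ?W" for v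
    proof (cases "v \<in> set C")
      case True
      then show ?thesis using new by simp
    next
      case False
      then have "v \<in> ?W" using v by blast
      then show ?thesis using c old unfolding partial_grundy_def by metis
    qed
    show "c' u \<noteq> c' v" if uv: "u \<in> set C \<union> ?W" "v \<in> set C \<union> ?W" "(u, v) \<in> parcs G" for u v
    proof (cases "u \<in> set C"; cases "v \<in> set C")
      assume "u \<in> set C" "v \<in> set C"
      then show ?thesis using indep uv by blast
    next
      assume a: "u \<in> set C" "v \<notin> set C"
      then have v: "v \<in> ?W" using uv by blast
      then have "c v \<le> length Cs" using le by blast
      then show ?thesis using new[OF a(1)] old[OF v] by simp
    next
      assume a: "u \<notin> set C" "v \<in> set C"
      then have u: "u \<in> ?W" using uv by blast
      then have "c u \<le> length Cs" using le by blast
      then show ?thesis using new[OF a(2)] old[OF u] by simp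
    next
      assume "u \<notin> set C" "v \<notin> set C"
      then have "u \<in> ?W" "v \<in> ?W" using uv by blast+
      then show ?thesis using c uv(3) old unfolding partial_grundy_def by metis
    qed
    show "\<exists>u \<in> set C \<union> ?W. (v, u) \<in> parcs G \<and> c' u = i"
      if v: "v \<in> set C \<union> ?W" and i: "1 \<le> i \<and> i < c' v" for v i
    proof (cases "v \<in> set C")
      case True
      then have "i \<in> {1..length Cs}" using i new by simp
      then obtain D where D: "D \<in> set Cs" "\<forall>u \<in> set D. c u = i" using ex by blast
      then obtain u where u: "u \<in> set D" "(v, u) \<in> parcs G" using nbr True by blast
      then have "u \<in> ?W" using D by auto
      then have "u \<in> set C \<union> ?W" "c' u = i" using u(1) D(2) old by simp_all
      then show ?thesis using u(2) by blast
    next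
      case False
      then have vW: "v \<in> ?W" using v by blast
      then obtain u where "u \<in> ?W" "(v, u) \<in> parcs G" "c u = i"
        using c i old[OF vW] unfolding partial_grundy_def by metis
      then show ?thesis using old by blast
    qed
  qed
  moreover have "\<forall>v \<in> set C \<union> ?W. c' v \<le> length (C # Cs)"
    using le old new by fastforce
  moreover have "\<exists>i. \<forall>v \<in> set D. c' v = i" if D: "D \<in> set (C # Cs)" for D
  proof (cases "D = C")
    case True
    then show ?thesis using new by blast
  next
    case False
    then have "D \<in> set Cs" using D by simp
    moreover from this have "set D \<subseteq> ?W" by auto
    ultimately show ?thesis using mono old by (metis subsetD)
  qed
  moreover have "\<exists>D \<in> set (C # Cs). \<forall>v \<in> set D. c' v = i" if i: "i \<in> {1..length (C # Cs)}" for i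
  proof (cases "i = length (C # Cs)")
    case True
    then show ?thesis using new by auto
  next
    case False
    then have "i \<in> {1..length Cs}" using i by auto
    then obtain D where D: "D \<in> set Cs" "\<forall>v \<in> set D. c v = i" using ex by blast
    moreover from this have "set D \<subseteq> ?W" by auto
    ultimately show ?thesis using old by (metis list.set_intros(2) subsetD)
  qed
  ultimately show ?case
    unfolding W by (intro exI[of _ c'] conjI ballI) (use new in auto)
qed

lemma layered_imp_not_grundy_le:
  assumes "pair_graph G" "layered (\<lambda>u v. (u, v) \<in> parcs G) Cs"
    and "set (concat Cs) \<subseteq> pverts G" "b < length Cs" "hd Cs \<noteq> []"
  shows "\<not> grundy_le G b"
proof
  assume le: "grundy_le G b"
  obtain c where c: "partial_grundy G (set (concat Cs)) c"
    "\<forall>v \<in> set (hd (Cs @ [[]])). c v = length Cs"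
    using layered_imp_partial_grundy[OF assms(1-3)] by blast
  obtain C Ds where "Cs = C # Ds" using assms(4) by (cases Cs) auto
  then have "hd C \<in> set (concat Cs)" "c (hd C) = length Cs"
    using c(2) assms(5) by auto
  then have "length Cs \<le> b" using le c(1) unfolding grundy_le_def by metis
  then show False using assms(4) by simp
qed

text \<open>Otherwise both legs of pair \<open>j\<close> take color 1, leg \<open>q\<close> of pair
  \<open>i\<close> color 2 and the hubs colors 3 and 4: that leg sees pair \<open>j\<close> along
  their edge, and each hub has a neighbor in every pair.\<close>

lemma leg_adjacent_to_both_hubs:
  assumes le: "grundy_le (frame k \<tau> s) 3" and ij: "i < k" "j < k" "i \<noteq> j"
    and hubs: "\<And>p. hub_adj (\<tau> i) p q"
  shows "s i j \<noteq> q"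
proof
  assume q: "s i j = q"
  have "\<exists>q. hub_adj (\<tau> j) p q" for p by (cases "\<tau> j") auto
  then have cover: "hub_adj (\<tau> j) p False \<or> hub_adj (\<tau> j) p True" for p by (metis (full_types))
  let ?Cs = "[[Hub True], [Hub False], [Leg i q], [Leg j False, Leg j True]]"
  have "layered (\<lambda>u v. (u, v) \<in> parcs (frame k \<tau> s)) ?Cs"
    using ij hubs cover q by auto
  then show False
    using layered_imp_not_grundy_le[OF pair_graph_frame, of k \<tau> s ?Cs 3] ij le by simp
qed

definition tri :: "'a \<Rightarrow> 'a \<Rightarrow> 'a \<Rightarrow> nat \<Rightarrow> 'a" where
  "tri x y z i = (case i of 0 \<Rightarrow> x | Suc j \<Rightarrow> (case j of 0 \<Rightarrow> y | Suc _ \<Rightarrow> z))"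

text \<open>
  Each clause is one configuration of three pairs that forces a Grundy coloring with four colors.
  Only one labelling of each is listed, since the triple is ordered; for three \<open>Split\<close> pairs
  the second disjunct is a cyclic orientation.
\<close>

definition bad_triple :: "link \<Rightarrow> link \<Rightarrow> link \<Rightarrow> (nat \<Rightarrow> nat \<Rightarrow> bool) \<Rightarrow> bool" where
  "bad_triple t0 t1 t2 s \<longleftrightarrow>
     (case (t0, t1) of
       (Split, Split) \<Rightarrow> s 0 1 = s 1 0 \<or>
         t2 = Split \<and> \<not> s 0 1 \<and> s 1 0 \<and> \<not> s 1 2 \<and> s 2 1 \<and> \<not> s 2 0 \<and> s 0 2
     | (Ear r, Split) \<Rightarrow> s 1 0 = r
     | (Ear r, Ear r') \<Rightarrow> r = r'
     | (Ear r, Pendant) \<Rightarrow> True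
     | (Pendant, Split) \<Rightarrow> t2 = Split
     | (Pendant, Pendant) \<Rightarrow> t2 = Split \<and> s 2 0 = s 2 1
     | _ \<Rightarrow> False)"

text \<open>
  The certificates were found by a computer search; they cover all bad triples.
\<close>

definition four_layers :: "vertex list list list" where
  "four_layers =
    [[[Hub True], [Leg 0 True], [Hub False, Leg 1 True], [Leg 2 False, Leg 2 True]],
     [[Hub True], [Hub False], [Leg 0 True, Leg 1 False], [Leg 1 True, Leg 2 False, Leg 2 True]],
     [[Hub False], [Hub True], [Leg 0 False, Leg 1 True], [Leg 1 False, Leg 2 False, Leg 2 True]],
     [[Hub False], [Leg 0 True], [Hub True, Leg 1 True], [Leg 2 False, Leg 2 True]],
     [[Hub False], [Leg 1 False], [Hub True, Leg 0 True], [Leg 2 False, Leg 2 True]],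
     [[Hub False], [Hub True], [Leg 1 False, Leg 2 True], [Leg 0 False, Leg 0 True, Leg 2 False]],
     [[Hub True], [Hub False], [Leg 1 True, Leg 2 False], [Leg 0 False, Leg 0 True, Leg 2 True]],
     [[Hub False], [Leg 0 False], [Hub True, Leg 1 False], [Leg 2 False, Leg 2 True]],
     [[Leg 2 True], [Hub True], [Leg 0 False, Leg 0 True], [Hub False, Leg 1 True]],
     [[Hub False], [Leg 2 False], [Hub True, Leg 0 True], [Leg 1 False, Leg 1 True]],
     [[Hub False], [Hub True], [Leg 0 True, Leg 1 True], [Leg 2 False, Leg 2 True]],
     [[Hub False], [Leg 2 False], [Leg 1 False], [Leg 0 False, Leg 0 True]],
     [[Hub True], [Leg 1 True], [Hub False, Leg 0 True], [Leg 2 False, Leg 2 True]],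
     [[Hub True], [Leg 2 True], [Hub False, Leg 0 True], [Leg 1 False, Leg 1 True]]]"

text \<open>\<open>Full\<close> is absent: next to another pair it contradicts the Grundy
  bound.\<close>

definition all_links :: "link list" where
  "all_links = [Split, Pendant, Ear False, Ear True]"

text \<open>The legs that can carry an edge to another pair. Leg \<open>False\<close> of a pair
  other than \<open>Split\<close> sees both hubs and is thereby excluded.\<close>

definition ends :: "link \<Rightarrow> bool list" where
  "ends t = (if t = Split then [False, True] else [True])"

text \<open>An evaluation over all links and all admissible edge ends. The diagonal of the table
  holds a placeholder, since a pair has no edge within itself.\<close>

lemma bad_triple_layered:
  "list_all (\<lambda>t0. list_all (\<lambda>t1. list_all (\<lambda>t2.
     list_all (\<lambda>b01. list_all (\<lambda>b02. list_all (\<lambda>b10. list_all (\<lambda>b12. list_all (\<lambda>b20. list_all (\<lambda>b21.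
       let s = tri (tri True b01 b02) (tri b10 True b12) (tri b20 b21 True) in
       bad_triple t0 t1 t2 s \<longrightarrow> list_ex (layered (adj (tri t0 t1 t2) s)) four_layers)
     (ends t2)) (ends t2)) (ends t1)) (ends t1)) (ends t0)) (ends t0))
   all_links) all_links) all_links"
  by code_simp

lemma layered_cong:
  assumes "\<And>u v. u \<in> set (concat Cs) \<Longrightarrow> v \<in> set (concat Cs) \<Longrightarrow> A u v = B u v"
  shows "layered A Cs = layered B Cs"
  using assms
proof (induction Cs)
  case (Cons C Cs)
  then have "layered A Cs = layered B Cs" by simp
  moreover have "A v u = B v u" if "v \<in> set C" "u \<in> set C \<or> (\<exists>D \<in> set Cs. u \<in> set D)" for u v
    using that by (intro Cons.prems) auto
  then have "list_ex (A v) C = list_ex (B v) C" "\<forall>D \<in> set Cs. list_ex (A v) D = list_ex (B v) D"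
    if "v \<in> set C" for v
    using that by (auto simp: list_ex_iff)
  then have "list_all (\<lambda>v. \<not> list_ex (A v) C \<and> list_all (list_ex (A v)) Cs) C =
      list_all (\<lambda>v. \<not> list_ex (B v) C \<and> list_all (list_ex (B v)) Cs) C"
    by (simp add: list_all_iff)
  ultimately show ?case by simp
qed simp

lemma four_layers_shape:
  assumes "Cs \<in> set four_layers"
  shows "length Cs = 4" "hd Cs \<noteq> []" "set (concat Cs) \<subseteq> vset 3"
proof -
  have "list_all (\<lambda>Cs. length Cs = 4 \<and> hd Cs \<noteq> [] \<and> set (concat Cs) \<subseteq> vset 3) four_layers"
    by (simp add: four_layers_def)
  then show "length Cs = 4" "hd Cs \<noteq> []" "set (concat Cs) \<subseteq> vset 3"
    using assms by (auto simp: list_all_iff)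
qed

lemma tri_simps [simp]: "tri x y z 0 = x" "tri x y z (Suc 0) = y" "tri x y z 2 = z"
  by (simp_all add: tri_def numeral_2_eq_2)

text \<open>Both legs of a \<open>Full\<close> pair see both hubs, so its edge to a second pair
  would have no admissible end.\<close>

lemma not_Full:
  assumes "grundy_le (frame k \<tau> s) 3" "2 \<le> k" "i < k"
  shows "\<tau> i \<noteq> Full"
proof
  assume t: "\<tau> i = Full"
  define j where "j = (if i = 0 then 1 else 0 :: nat)"
  have "j < k" "i \<noteq> j" using assms(2) by (auto simp: j_def)
  then have "s i j \<noteq> q" for q
    using leg_adjacent_to_both_hubs[OF assms(1,3)] t by simp
  then show False by blast
qed

lemma split_or_True:
  assumes "grundy_le (frame k \<tau> s) 3" "i < k" "j < k" "i \<noteq> j"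
  shows "\<tau> i = Split \<or> s i j"
  using leg_adjacent_to_both_hubs[OF assms, of False] by (cases "\<tau> i") auto

text \<open>Three pairs together with the hubs induce a frame with three pairs, up to renaming by
  \<open>tri i j l\<close>. The Grundy bound passes to it and contradicts the evaluated
  certificate.\<close>

lemma no_bad_triple:
  assumes le: "grundy_le (frame k \<tau> s) 3" and d: "i < k" "j < k" "l < k" "distinct [i, j, l]"
  shows "\<not> bad_triple (\<tau> i) (\<tau> j) (\<tau> l) (\<lambda>m n. s (tri i j l m) (tri i j l n))" (is "\<not> bad_triple _ _ _ ?s")
proof
  assume bad: "bad_triple (\<tau> i) (\<tau> j) (\<tau> l) ?s"
  define s' where "s' = tri (tri True (s i j) (s i l)) (tri (s j i) True (s j l)) (tri (s l i) (s l j) True)"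
  have k: "2 \<le> k" using d by auto
  have link: "\<tau> m \<in> set all_links" if "m < k" for m
  proof (cases "\<tau> m")
    case (Ear r)
    then show ?thesis by (cases r) (simp_all add: all_links_def)
  qed (use not_Full[OF le k that] in \<open>simp_all add: all_links_def\<close>)
  have ends: "s m n \<in> set (ends (\<tau> m))" if "m < k" "n < k" "m \<noteq> n" for m n
    using split_or_True[OF le that] by (auto simp: ends_def)
  have "bad_triple (\<tau> i) (\<tau> j) (\<tau> l) s'"
    using bad by (simp add: bad_triple_def s'_def split: link.splits)
  moreover have "\<forall>t0 \<in> set all_links. \<forall>t1 \<in> set all_links. \<forall>t2 \<in> set all_links.
     \<forall>b01 \<in> set (ends t0). \<forall>b02 \<in> set (ends t0). \<forall>b10 \<in> set (ends t1). \<forall>b12 \<in> set (ends t1).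
     \<forall>b20 \<in> set (ends t2). \<forall>b21 \<in> set (ends t2).
       bad_triple t0 t1 t2 (tri (tri True b01 b02) (tri b10 True b12) (tri b20 b21 True)) \<longrightarrow>
       (\<exists>Cs \<in> set four_layers.
          layered (adj (tri t0 t1 t2) (tri (tri True b01 b02) (tri b10 True b12) (tri b20 b21 True))) Cs)"
    using bad_triple_layered unfolding list_all_iff list_ex_iff Let_def .
  ultimately obtain Cs where Cs: "Cs \<in> set four_layers" "layered (adj (tri (\<tau> i) (\<tau> j) (\<tau> l)) s') Cs"
    using link ends d unfolding s'_def by (metis distinct_length_2_or_more)
  let ?H = "frame 3 (tri (\<tau> i) (\<tau> j) (\<tau> l)) s'"
  note shape = four_layers_shape[OF Cs(1)]
  have "layered (\<lambda>u v. (u, v) \<in> parcs ?H) Cs"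
    using Cs(2) shape(3) by (subst layered_cong[where B = "adj (tri (\<tau> i) (\<tau> j) (\<tau> l)) s'"]) auto
  then have "\<not> grundy_le ?H 3"
    using shape by (intro layered_imp_not_grundy_le[OF pair_graph_frame]) auto
  define f where "f v = (case v of Hub p \<Rightarrow> Hub p | Leg m q \<Rightarrow> Leg (tri i j l m) q)" for v
  have lt3: "m = 0 \<or> m = 1 \<or> m = 2" if "m < 3" for m :: nat using that by auto
  have f: "f (Hub p) = Hub p" "f (Leg m q) = Leg (tri i j l m) q" for p m q
    by (simp_all add: f_def)
  have tri_lt: "tri i j l m < k" if "m < 3" for m
    using lt3[OF that] d by auto
  have tri_inj: "tri i j l m = tri i j l n \<longleftrightarrow> m = n" if "m < 3" "n < 3" for m n
    using lt3[OF that(1)] lt3[OF that(2)] d(4) by auto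
  have tri_\<tau>: "\<tau> (tri i j l m) = tri (\<tau> i) (\<tau> j) (\<tau> l) m" if "m < 3" for m
    using lt3[OF that] by auto
  have tri_s: "s (tri i j l m) (tri i j l n) = s' m n" if "m < 3" "n < 3" "m \<noteq> n" for m n
    using lt3[OF that(1)] lt3[OF that(2)] that(3) by (auto simp: s'_def)
  have "grundy_le ?H 3"
  proof (rule grundy_le_embedding[OF le])
    show "inj_on f (pverts ?H)"
    proof (rule inj_onI)
      fix u v assume "u \<in> pverts ?H" "v \<in> pverts ?H" "f u = f v"
      then show "u = v" using tri_inj by (cases u; cases v) (auto simp: f)
    qed
    show "f ` pverts ?H \<subseteq> pverts (frame k \<tau> s)"
    proof (rule image_subsetI)
      fix v assume "v \<in> pverts ?H"
      then show "f v \<in> pverts (frame k \<tau> s)" using tri_lt by (cases v) (auto simp: f)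
    qed
    fix u v assume "u \<in> pverts ?H" "v \<in> pverts ?H"
    then show "(f u, f v) \<in> parcs (frame k \<tau> s) \<longleftrightarrow> (u, v) \<in> parcs ?H"
      using tri_lt tri_inj tri_\<tau> tri_s by (cases u; cases v) (auto simp: f)
  qed
  then show False using \<open>\<not> grundy_le ?H 3\<close> by blast
qed

section \<open>Classification for at least three pairs\<close>

lemma frame_cong:
  assumes "\<And>i. i < k \<Longrightarrow> \<tau> i = \<tau>' i"
    and "\<And>i j. i < k \<Longrightarrow> j < k \<Longrightarrow> i \<noteq> j \<Longrightarrow> s i j = s' i j"
  shows "frame k \<tau> s = frame k \<tau>' s'"
proof -
  have "adj \<tau> s u v = adj \<tau>' s' u v" if "u \<in> vset k" "v \<in> vset k" for u v
    using that assms by (cases u; cases v) auto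
  then show ?thesis by (auto simp: frame_def)
qed

lemma frame_perm:
  assumes "bij_betw \<pi> {..<k} {..<k}"
  shows "isomorphic (frame k (\<lambda>i. \<tau> (\<pi> i)) (\<lambda>i j. s (\<pi> i) (\<pi> j))) (frame k \<tau> s)"
proof -
  define f where "f v = (case v of Hub p \<Rightarrow> Hub p | Leg i q \<Rightarrow> Leg (\<pi> i) q)" for v
  have f: "f (Hub p) = Hub p" "f (Leg i q) = Leg (\<pi> i) q" for p i q by (simp_all add: f_def)
  have lt: "\<pi> i < k" if "i < k" for i using assms that by (meson bij_betwE lessThan_iff)
  have inj: "\<pi> i = \<pi> j \<longleftrightarrow> i = j" if "i < k" "j < k" for i j
    using assms that by (metis bij_betw_def inj_onD lessThan_iff)
  have "inj_on f (vset k)"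
  proof (rule inj_onI)
    fix u v assume "u \<in> vset k" "v \<in> vset k" "f u = f v"
    then show "u = v" using inj by (cases u; cases v) (auto simp: f)
  qed
  moreover have sub: "f ` vset k \<subseteq> vset k"
  proof (rule image_subsetI)
    fix v assume "v \<in> vset k"
    then show "f v \<in> vset k" using lt by (cases v) (auto simp: f)
  qed
  ultimately have "bij_betw f (vset k) (vset k)"
    by (simp add: bij_betw_def endo_inj_surj)
  moreover have "adj \<tau> s (f u) (f v) = adj (\<lambda>i. \<tau> (\<pi> i)) (\<lambda>i j. s (\<pi> i) (\<pi> j)) u v"
    if "u \<in> vset k" "v \<in> vset k" for u v
    using that inj by (cases u; cases v) (auto simp: f)
  ultimately show ?thesis
    unfolding isomorphic_def using sub by (intro exI[of _ f]) auto
qed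

text \<open>
  Exchanging the hubs changes the sign of an \<open>Ear\<close>; for a \<open>Split\<close> pair the legs have to be exchanged
  as well.
\<close>

fun flip :: "link \<Rightarrow> link" where
  "flip (Ear r) = Ear (\<not> r)"
| "flip t = t"

lemma frame_flip:
  "isomorphic (frame k \<tau> s) (frame k (\<lambda>i. flip (\<tau> i)) (\<lambda>i j. s i j \<noteq> (\<tau> i = Split)))"
proof -
  define f where
    "f v = (case v of Hub p \<Rightarrow> Hub (\<not> p) | Leg i q \<Rightarrow> Leg i (q \<noteq> (\<tau> i = Split)))" for v
  have f: "f (Hub p) = Hub (\<not> p)" "f (Leg i q) = Leg i (q \<noteq> (\<tau> i = Split))" for p i q
    by (simp_all add: f_def)
  have "f (f v) = v" for v by (cases v) (auto simp: f)
  then have "bij_betw f (vset k) (f ` vset k)" by (metis bij_betw_def inj_on_inverseI)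
  moreover have in_f: "f v \<in> vset k \<longleftrightarrow> v \<in> vset k" for v by (cases v) (auto simp: f)
  have "f ` vset k = vset k"
  proof (intro equalityI subsetI)
    fix v assume "v \<in> vset k"
    then show "v \<in> f ` vset k" using in_f \<open>\<And>v. f (f v) = v\<close> by (metis imageI)
  qed (use in_f in auto)
  moreover have hub: "hub_adj (flip t) (\<not> p) (q = (t \<noteq> Split)) = hub_adj t p q" for t p q
    by (cases t) auto
  have "adj (\<lambda>i. flip (\<tau> i)) (\<lambda>i j. s i j \<noteq> (\<tau> i = Split)) (f u) (f v) = adj \<tau> s u v" for u v
    by (cases u; cases v) (auto simp: f hub)
  ultimately show ?thesis
    unfolding isomorphic_def using in_f by (intro exI[of _ f]) auto
qed

text \<open>The rank, that is the number of predecessors, is strictly increasing along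
  \<open>r\<close>; by totality it is injective into \<open>{..<card J}\<close> and hence bijective.
  Its inverse is the enumeration.\<close>

lemma exists_sorted_enumeration:
  fixes r :: "'a \<Rightarrow> 'a \<Rightarrow> bool"
  assumes J: "finite J" and total: "\<And>i j. i \<in> J \<Longrightarrow> j \<in> J \<Longrightarrow> i \<noteq> j \<Longrightarrow> r i j \<or> r j i"
    and asym: "\<And>i j. r i j \<Longrightarrow> \<not> r j i"
    and trans: "\<And>i j l. i \<in> J \<Longrightarrow> j \<in> J \<Longrightarrow> l \<in> J \<Longrightarrow> r i j \<Longrightarrow> r j l \<Longrightarrow> r i l"
  shows "\<exists>g. bij_betw g {..<card J} J \<and> (\<forall>m n. m < n \<longrightarrow> n < card J \<longrightarrow> r (g m) (g n))"
proof -
  define \<rho> where "\<rho> j = card {i \<in> J. r i j}" for j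
  have less: "\<rho> i < \<rho> j" if "i \<in> J" "j \<in> J" "r i j" for i j
    unfolding \<rho>_def
  proof (rule psubset_card_mono)
    show "finite {i \<in> J. r i j}" using J by simp
    have "i \<notin> {x \<in> J. r x i}" using asym by blast
    moreover have "i \<in> {x \<in> J. r x j}" using that by blast
    moreover have "{x \<in> J. r x i} \<subseteq> {x \<in> J. r x j}" using trans that by blast
    ultimately show "{x \<in> J. r x i} \<subset> {x \<in> J. r x j}" by blast
  qed
  have inj: "inj_on \<rho> J"
  proof (rule inj_onI, rule ccontr)
    fix i j assume "i \<in> J" "j \<in> J" "\<rho> i = \<rho> j" "i \<noteq> j"
    then show False using total less by (metis less_irrefl)
  qed
  have "\<rho> j < card J" if j: "j \<in> J" for j
    unfolding \<rho>_def
  proof (rule psubset_card_mono[OF J])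
    show "{i \<in> J. r i j} \<subset> J" using asym j by blast
  qed
  then have "\<rho> ` J \<subseteq> {..<card J}" by blast
  then have "\<rho> ` J = {..<card J}"
    using inj by (intro card_subset_eq) (simp_all add: card_image)
  then have \<rho>: "bij_betw \<rho> J {..<card J}" using inj by (simp add: bij_betw_def)
  let ?g = "the_inv_into J \<rho>"
  have g: "bij_betw ?g {..<card J} J" using \<rho> by (rule bij_betw_the_inv_into)
  have \<rho>g: "\<rho> (?g m) = m" "?g m \<in> J" if "m < card J" for m
    using that \<rho> g by (auto simp: bij_betw_def f_the_inv_into_f)
  have "r (?g m) (?g n)" if mn: "m < n" "n < card J" for m n
  proof -
    have m: "m < card J" using mn by simp
    have "?g m \<noteq> ?g n" using \<rho>g(1)[OF m] \<rho>g(1)[OF mn(2)] mn(1) by auto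
    moreover have "\<not> r (?g n) (?g m)"
      using less[OF \<rho>g(2)[OF mn(2)] \<rho>g(2)[OF m]] \<rho>g(1)[OF m] \<rho>g(1)[OF mn(2)] mn(1) by auto
    ultimately show ?thesis using total \<rho>g(2)[OF m] \<rho>g(2)[OF mn(2)] by blast
  qed
  then show ?thesis using g by blast
qed

text \<open>
  The first \<open>e\<close> pairs are ears, one at each hub if \<open>e = 2\<close>; the others form a half graph.
\<close>

definition stair :: "nat \<Rightarrow> nat \<Rightarrow> vertex pair_pre_digraph" where
  "stair k e = frame k (\<lambda>i. if i < e then Ear (i = 1) else Split)
     (\<lambda>i j. i < e \<or> j < i \<and> \<not> (e = 2 \<and> j = 1))"

text \<open>A six-cycle with two further vertices joined to both ends of one of its edges. The two
  pendant pairs are joined to different legs of the \<open>Split\<close> pair.\<close>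

definition tripod :: "vertex pair_pre_digraph" where
  "tripod = frame 3 (tri Pendant Pendant Split) (tri (\<lambda>_. True) (\<lambda>_. True) (\<lambda>j. j = 1))"

text \<open>Each leg avoids the color of its own hub, and the opposite ends keep the edges between
  pairs proper. Chromatic number 3 therefore rules this case out.\<close>

lemma split_frame_two_coloring:
  assumes split: "\<And>i. i < k \<Longrightarrow> \<tau> i = Split"
    and s: "\<And>i j. i < k \<Longrightarrow> j < k \<Longrightarrow> i \<noteq> j \<Longrightarrow> s i j \<noteq> s j i"
  shows "\<exists>c. proper_coloring (frame k \<tau> s) 2 c"
proof -
  define c :: "vertex \<Rightarrow> nat" where
    "c v = (case v of Hub p \<Rightarrow> if p then 2 else 1 | Leg i q \<Rightarrow> if q then 1 else 2)" for v
  have c: "c (Hub p) = (if p then 2 else 1)" "c (Leg i q) = (if q then 1 else 2)" for p i q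
    by (simp_all add: c_def)
  have "c u \<noteq> c v" if uv: "(u, v) \<in> parcs (frame k \<tau> s)" for u v
  proof (cases u; cases v)
    fix i p j q assume l: "u = Leg i p" "v = Leg j q"
    then have "i < k" "j < k" "i \<noteq> j" "s i j = p" "s j i = q" using uv by auto
    then show ?thesis using s[of i j] l by (auto simp: c)
  qed (use uv split in \<open>auto simp: c\<close>)
  moreover have "c v \<in> {1..2}" for v by (cases v) (auto simp: c)
  ultimately show ?thesis
    unfolding proper_coloring_def by (intro exI[of _ c]) blast
qed

text \<open>The legs \<open>True\<close> see no hub and their edges to other pairs end at legs
  \<open>True\<close> again, so they are cut off from the hubs.\<close>

lemma pendant_frame_not_connected:
  assumes k: "0 < k" and pendant: "\<And>i. i < k \<Longrightarrow> \<tau> i = Pendant"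
    and s: "\<And>i j. i < k \<Longrightarrow> j < k \<Longrightarrow> i \<noteq> j \<Longrightarrow> s i j"
  shows "\<not> connected (with_proj (frame k \<tau> s))"
proof
  assume conn: "connected (with_proj (frame k \<tau> s))"
  let ?S = "(\<lambda>j. Leg j True) ` {..<k}"
  have "v \<in> ?S" if uv: "(u, v) \<in> parcs (frame k \<tau> s)" "u \<in> ?S" for u v
  proof -
    obtain j where j: "u = Leg j True" "j < k" using uv by blast
    show ?thesis
    proof (cases v)
      case (Hub p)
      then show ?thesis using uv j pendant by simp
    next
      case (Leg l q)
      then have "q = s l j" "l < k" "l \<noteq> j" using uv j by auto
      then show ?thesis using Leg j s by auto
    qed
  qed
  moreover have "?S \<subseteq> pverts (frame k \<tau> s)" by auto
  moreover have "?S \<noteq> {}" using k by (auto simp: lessThan_empty_iff)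
  ultimately have "?S = pverts (frame k \<tau> s)"
    by (intro connected_closed_set[OF pair_graph_frame conn])
  moreover have "Hub True \<notin> ?S" by blast
  ultimately show False by simp
qed

text \<open>With three pairs present any two of them extend to a triple, so the clauses of
  \<open>bad_triple\<close> that mention only two pairs become constraints on any two. With only two
  pairs several of these constraints fail, which is why that case is separate.\<close>

locale narrow_frame =
  fixes k :: nat and \<tau> :: "nat \<Rightarrow> link" and s :: "nat \<Rightarrow> nat \<Rightarrow> bool"
  assumes le: "grundy_le (frame k \<tau> s) 3" and k: "3 \<le> k"
begin

lemma third:
  assumes "i < k" "j < k"
  shows "\<exists>l < k. l \<noteq> i \<and> l \<noteq> j"
proof -
  have "\<not> {..<k} \<subseteq> {i, j}"
    using k card_mono[of "{i, j}" "{..<k}"] by (auto simp: card_insert_if split: if_splits)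
  then show ?thesis by blast
qed

lemmas no_bad = no_bad_triple[OF le, unfolded bad_triple_def, simplified]

lemma split_split: "s i j \<noteq> s j i"
  if "i < k" "j < k" "i \<noteq> j" "\<tau> i = Split" "\<tau> j = Split"
proof -
  have "\<exists>l < k. l \<noteq> i \<and> l \<noteq> j" using third that by blast
  then obtain l where "l < k" "l \<noteq> i" "l \<noteq> j" by blast
  then show ?thesis using no_bad[of i j l] that by simp
qed

lemma ear_split: "s j i \<noteq> r"
  if "i < k" "j < k" "i \<noteq> j" "\<tau> i = Ear r" "\<tau> j = Split"
proof -
  have "\<exists>l < k. l \<noteq> i \<and> l \<noteq> j" using third that by blast
  then obtain l where "l < k" "l \<noteq> i" "l \<noteq> j" by blast
  then show ?thesis using no_bad[of i j l] that by simp
qed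

lemma ear_other: "\<tau> j \<noteq> Ear r" "\<tau> j \<noteq> Pendant"
  if "i < k" "j < k" "i \<noteq> j" "\<tau> i = Ear r"
proof -
  have "\<exists>l < k. l \<noteq> i \<and> l \<noteq> j" using third that by blast
  then obtain l where "l < k" "l \<noteq> i" "l \<noteq> j" by blast
  then show "\<tau> j \<noteq> Ear r" "\<tau> j \<noteq> Pendant"
    using no_bad[of i j l] that by auto
qed

lemma pendant_split_split: "\<tau> j \<noteq> Split"
  if "i < k" "j < k" "l < k" "i \<noteq> j" "l \<noteq> j" "\<tau> i = Pendant" "\<tau> l = Split"
proof -
  have "i \<noteq> l" using that by auto
  then show ?thesis using no_bad[of i l j] that by auto
qed

lemma pendant_pendant_split: "s l i \<noteq> s l j"
  if "i < k" "j < k" "l < k" "i \<noteq> j" "\<tau> i = Pendant" "\<tau> j = Pendant" "\<tau> l = Split"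
proof -
  have "l \<noteq> i" "l \<noteq> j" using that by auto
  then show ?thesis using no_bad[of i j l] that by auto
qed

text \<open>The ends of the edges orient the \<open>Split\<close> pairs as a tournament; a cyclic
  triple is bad, so the tournament is transitive.\<close>

lemma split_trans: "\<not> s i l \<and> s l i"
  if "i < k" "j < k" "l < k" "\<tau> i = Split" "\<tau> j = Split" "\<tau> l = Split"
    "i \<noteq> j" "j \<noteq> l" "i \<noteq> l" "\<not> s i j" "s j i" "\<not> s j l" "s l j"
  using no_bad[of i j l] that split_split[of i l] by auto

text \<open>The \<open>Split\<close> pairs carry a transitive tournament and can be sorted. Listing
  the ears before them determines every remaining end: an ear uses leg \<open>True\<close>, and a
  \<open>Split\<close> pair avoids its leg at the hub of the ear.\<close>

lemma stair_iso:
  assumes e: "e = 1 \<or> e = 2" and ear: "inj_on ear {..<e}" "\<And>m. m < e \<Longrightarrow> ear m < k \<and> \<tau> (ear m) = Ear (m = 1)"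
    and rest: "\<And>i. i < k \<Longrightarrow> i \<notin> ear ` {..<e} \<Longrightarrow> \<tau> i = Split"
  shows "isomorphic (frame k \<tau> s) (stair k e)"
proof -
  let ?J = "{..<k} - ear ` {..<e}"
  define r where "r i j \<longleftrightarrow> i \<in> ?J \<and> j \<in> ?J \<and> i \<noteq> j \<and> \<not> s i j \<and> s j i" for i j
  have split: "i < k" "\<tau> i = Split" if "i \<in> ?J" for i using that rest by blast+
  have sub: "ear ` {..<e} \<subseteq> {..<k}" using ear(2) by blast
  have card: "card ?J = k - e"
    using sub ear(1) by (simp add: card_Diff_subset card_image)
  have "\<exists>g. bij_betw g {..<card ?J} ?J \<and> (\<forall>m n. m < n \<longrightarrow> n < card ?J \<longrightarrow> r (g m) (g n))"
  proof (rule exists_sorted_enumeration)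
    show "r i j \<or> r j i" if "i \<in> ?J" "j \<in> ?J" "i \<noteq> j" for i j
      using split_split[of i j] split that unfolding r_def by blast
    show "r i l" if "r i j" "r j l" for i j l
    proof -
      have ij: "i \<in> ?J" "j \<in> ?J" "i \<noteq> j" "\<not> s i j" "s j i"
        and jl: "l \<in> ?J" "j \<noteq> l" "\<not> s j l" "s l j"
        using that unfolding r_def by blast+
      then have "i \<noteq> l" by auto
      then show ?thesis
        using split_trans[of i j l] split ij jl unfolding r_def by blast
    qed
  qed (auto simp: r_def)
  then obtain g where g: "bij_betw g {..<k - e} ?J"
    and r: "\<And>m n. m < n \<Longrightarrow> n < k - e \<Longrightarrow> r (g m) (g n)"
    unfolding card by blast
  define \<pi> where "\<pi> m = (if m < e then ear m else g (m - e))" for m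
  have ek: "e \<le> k" using e k by auto
  have "bij_betw \<pi> {..<e} (ear ` {..<e})"
    using ear(1) by (auto simp: bij_betw_def \<pi>_def inj_on_def)
  moreover have "bij_betw \<pi> {e..<k} ?J"
  proof -
    have "bij_betw (\<lambda>m. m - e) {e..<k} {..<k - e}"
      by (rule bij_betw_byWitness[where f' = "\<lambda>m. m + e"]) auto
    then have "bij_betw (g \<circ> (\<lambda>m. m - e)) {e..<k} ?J" using g by (rule bij_betw_trans)
    then show ?thesis by (rule iffD1[OF bij_betw_cong, rotated]) (auto simp: \<pi>_def)
  qed
  ultimately have "bij_betw \<pi> ({..<e} \<union> {e..<k}) (ear ` {..<e} \<union> ?J)"
    by (rule bij_betw_combine) blast
  moreover have "{..<e} \<union> {e..<k} = {..<k}" using ek by auto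
  moreover have "ear ` {..<e} \<union> ?J = {..<k}" using sub by blast
  ultimately have \<pi>: "bij_betw \<pi> {..<k} {..<k}" by simp
  have \<pi>J: "\<pi> m \<in> ?J" if "e \<le> m" "m < k" for m
    using bij_betwE[OF g, rule_format, of "m - e"] that by (simp add: \<pi>_def)
  have \<pi>k: "\<pi> m < k" if "m < k" for m using \<pi> that by (meson bij_betwE lessThan_iff)
  have inj: "\<pi> m \<noteq> \<pi> n" if "m < k" "n < k" "m \<noteq> n" for m n
    using \<pi> that by (metis bij_betw_def inj_onD lessThan_iff)
  have \<tau>: "\<tau> (\<pi> m) = (if m < e then Ear (m = 1) else Split)" if "m < k" for m
  proof (cases "m < e")
    case True
    then show ?thesis using ear(2) by (simp add: \<pi>_def)
  next
    case False
    then show ?thesis using split(2) \<pi>J that by simp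
  qed
  have "s (\<pi> m) (\<pi> n) = (m < e \<or> n < m \<and> \<not> (e = 2 \<and> n = 1))"
    if mn: "m < k" "n < k" "m \<noteq> n" for m n
  proof (cases "m < e")
    case True
    then show ?thesis
      using split_or_True[OF le \<pi>k[OF mn(1)] \<pi>k[OF mn(2)] inj[OF mn]] \<tau>[OF mn(1)] by simp
  next
    case m: False
    show ?thesis
    proof (cases "n < e")
      case True
      \<comment> \<open>Ear \<open>n\<close> is attached to the hub \<open>n = 1\<close>, so the
        opposite leg of the \<open>Split\<close> pair is used. This produces the exception for
        \<open>j = 1\<close> in \<open>stair\<close>.\<close>
      then have "s (\<pi> m) (\<pi> n) \<noteq> (n = 1)"
        using ear_split[of "\<pi> n" "\<pi> m" "n = 1"] \<tau>[OF mn(1)] \<tau>[OF mn(2)] m mn inj \<pi>k by simp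
      then show ?thesis using m True e by auto
    next
      case n: False
      have "r (\<pi> m) (\<pi> n)" if "m < n"
        using r[of "m - e" "n - e"] that m n mn by (simp add: \<pi>_def)
      moreover have "r (\<pi> n) (\<pi> m)" if "n < m"
        using r[of "n - e" "m - e"] that m n mn by (simp add: \<pi>_def)
      ultimately have "s (\<pi> m) (\<pi> n) = (n < m)"
        using mn(3) unfolding r_def by (metis linorder_neqE_nat order_less_asym)
      then show ?thesis using m n by auto
    qed
  qed
  then have "frame k (\<lambda>m. \<tau> (\<pi> m)) (\<lambda>m n. s (\<pi> m) (\<pi> n)) = stair k e"
    unfolding stair_def using \<tau> by (intro frame_cong) auto
  then show ?thesis using frame_perm[OF \<pi>, of \<tau> s] isomorphic_sym by simp
qed

text \<open>A pendant pair tolerates no ear and at most one \<open>Split\<close> pair, while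
  connectedness requires one. Two pendant pairs must be joined to different legs of it, so there are
  at most two of them, which caps \<open>k\<close> at 3.\<close>

lemma pendant_imp_tripod:
  assumes conn: "connected (with_proj (frame k \<tau> s))" and i: "i < k" "\<tau> i = Pendant"
  shows "k = 3 \<and> isomorphic (frame k \<tau> s) tripod"
proof -
  have kinds: "\<tau> j = Pendant \<or> \<tau> j = Split" if "j < k" for j
  proof (cases "j = i")
    case False
    then have "\<tau> j \<noteq> Ear r" for r using ear_other(2)[of j i r] i that by auto
    moreover have "\<tau> j \<noteq> Full" using not_Full[OF le _ that] k by simp
    ultimately show ?thesis by (metis link.exhaust)
  qed (use i in simp)
  have "\<exists>l < k. \<tau> l = Split"
  proof (rule ccontr)
    assume "\<not> ?thesis"
    then have all: "\<tau> j = Pendant" if "j < k" for j using kinds that by blast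
    have "s i j" if "i < k" "j < k" "i \<noteq> j" for i j
      using split_or_True[OF le that] all[OF that(1)] by simp
    then have "\<not> connected (with_proj (frame k \<tau> s))"
      using all k by (intro pendant_frame_not_connected) simp_all
    then show False using conn by contradiction
  qed
  then obtain l where l: "l < k" "\<tau> l = Split" by blast
  have others: "\<tau> j = Pendant" if "j < k" "j \<noteq> l" for j
  proof (cases "j = i")
    case False
    then show ?thesis using pendant_split_split[of i j l] kinds l i that by blast
  qed (use i in simp)
  let ?J = "{..<k} - {l}"
  have "inj_on (s l) ?J"
    using pendant_pendant_split[of _ _ l] others l by (intro inj_onI) blast
  then have "card ?J \<le> card (UNIV :: bool set)" by (rule card_inj_on_le) auto
  then have k3: "k = 3" using k l(1) by simp
  then have "card ?J = 2" using l by simp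
  then obtain a b where ab: "?J = {a, b}" "a \<noteq> b" unfolding card_2_iff by blast
  have "\<exists>i j. ?J = {i, j} \<and> i \<noteq> j \<and> \<not> s l i"
  proof (cases "s l a")
    case True
    have "a \<in> ?J" "b \<in> ?J" using ab by auto
    then have "s l a \<noteq> s l b"
      using pendant_pendant_split[of a b l] others l ab(2) by blast
    then show ?thesis using ab True by (metis insert_commute)
  qed (use ab in blast)
  then obtain i j where ij: "?J = {i, j}" "i \<noteq> j" "\<not> s l i" by blast
  have "i \<in> ?J" "j \<in> ?J" using ij by auto
  then have lt: "i < k" "j < k" and ne: "i \<noteq> l" "j \<noteq> l" by auto
  then have \<tau>: "\<tau> i = Pendant" "\<tau> j = Pendant" using others by blast+
  have slj: "s l j" using pendant_pendant_split[of i j l] \<tau> lt l ij by blast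
  have lt3: "m = 0 \<or> m = 1 \<or> m = 2" if "m < 3" for m :: nat using that by auto
  have "inj_on (tri i j l) {..<3}"
  proof (rule inj_onI)
    fix m n :: nat assume "m \<in> {..<3}" "n \<in> {..<3}" "tri i j l m = tri i j l n"
    then show "m = n" using lt3[of m] lt3[of n] ij(2) ne by auto
  qed
  moreover have "tri i j l ` {..<3} \<subseteq> {..<3}"
  proof (rule image_subsetI)
    fix m :: nat assume "m \<in> {..<3}"
    then show "tri i j l m \<in> {..<3}" using lt3[of m] lt l k3 by auto
  qed
  ultimately have bij: "bij_betw (tri i j l) {..<3} {..<3}"
    by (simp add: bij_betw_def endo_inj_surj)
  have sT: "s i m" "s j m" if "m < k" "m \<noteq> i" "m \<noteq> j" for m
    using split_or_True[OF le] lt that \<tau> by (metis link.distinct(1))+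
  have sij: "s i j" "s j i"
    using split_or_True[OF le] lt ij \<tau> by (metis link.distinct(1))+
  have "frame 3 (\<lambda>m. \<tau> (tri i j l m)) (\<lambda>m n. s (tri i j l m) (tri i j l n)) = tripod"
    unfolding tripod_def
  proof (rule frame_cong)
    fix m :: nat assume "m < 3"
    then show "\<tau> (tri i j l m) = tri Pendant Pendant Split m" using lt3[of m] \<tau> l by auto
  next
    fix m n :: nat assume "m < 3" "n < 3" "m \<noteq> n"
    then show "s (tri i j l m) (tri i j l n) = tri (\<lambda>_. True) (\<lambda>_. True) (\<lambda>j. j = 1) m n"
      using lt3[of m] lt3[of n] sT[of l] sij slj ij(3) l ne by auto
  qed
  then have "isomorphic (frame k \<tau> s) tripod"
    using frame_perm[OF bij, of \<tau> s] isomorphic_sym unfolding k3 by simp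
  then show ?thesis using k3 by blast
qed

text \<open>Without pendant pairs only \<open>Split\<close> pairs and ears remain. An ear exists
  because \<open>Split\<close> pairs alone give a bipartite graph, and each hub has at most
  one.\<close>

lemma classification:
  assumes conn: "connected (with_proj (frame k \<tau> s))"
    and chi: "\<And>c. \<not> proper_coloring (frame k \<tau> s) 2 c"
  shows "k = 3 \<and> isomorphic (frame k \<tau> s) tripod \<or>
    isomorphic (frame k \<tau> s) (stair k 1) \<or> isomorphic (frame k \<tau> s) (stair k 2)"
proof (cases "\<exists>i < k. \<tau> i = Pendant")
  case True
  then show ?thesis using pendant_imp_tripod[OF conn] by blast
next
  case False
  have kinds: "\<tau> j = Split \<or> (\<exists>r. \<tau> j = Ear r)" if "j < k" for j
    using not_Full[OF le _ that] k False that by (cases "\<tau> j") auto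
  have "\<exists>i < k. \<exists>r. \<tau> i = Ear r"
  proof (rule ccontr)
    assume "\<not> ?thesis"
    then have split: "\<tau> j = Split" if "j < k" for j using kinds that by blast
    then have "\<exists>c. proper_coloring (frame k \<tau> s) 2 c"
      using split_split by (intro split_frame_two_coloring) blast+
    then show False using chi by blast
  qed
  then obtain i r where i: "i < k" "\<tau> i = Ear r" by blast
  show ?thesis
  proof (cases "\<exists>j < k. j \<noteq> i \<and> \<tau> j \<noteq> Split")
    case True
    then obtain j r' where j: "j < k" "j \<noteq> i" "\<tau> j = Ear r'" using kinds by blast
    have r': "r' \<longleftrightarrow> \<not> r" using ear_other(1)[of i j r] i j by auto
    \<comment> \<open>Index 1 has to be the ear at hub \<open>True\<close>, whichever of
      \<open>i\<close> and \<open>j\<close> that is.\<close>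
    define ear where "ear m = (if (m = 1) = r then i else j)" for m :: nat
    have "isomorphic (frame k \<tau> s) (stair k 2)"
    proof (rule stair_iso)
      have lt2: "m = 0 \<or> m = 1" if "m < 2" for m :: nat using that by auto
      show "inj_on ear {..<2}"
      proof (rule inj_onI)
        fix m n :: nat assume "m \<in> {..<2}" "n \<in> {..<2}" "ear m = ear n"
        then show "m = n"
          using lt2[of m] lt2[of n] j(2) by (auto simp: ear_def split: if_splits)
      qed
      show "ear m < k \<and> \<tau> (ear m) = Ear (m = 1)" if "m < 2" for m
        using lt2[OF that] i j r' by (auto simp: ear_def)
      have "ear 0 \<in> ear ` {..<2}" "ear 1 \<in> ear ` {..<2}" by auto
      then have range: "i \<in> ear ` {..<2}" "j \<in> ear ` {..<2}"
        by (auto simp: ear_def split: if_splits)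
      show "\<tau> l = Split" if l: "l < k" "l \<notin> ear ` {..<2}" for l
      proof -
        have "l \<noteq> i" "l \<noteq> j" using l(2) range by metis+
        then have "\<tau> l \<noteq> Ear r" "\<tau> l \<noteq> Ear r'"
          using ear_other(1)[of i l r] ear_other(1)[of j l r'] l(1) i j by simp_all
        then have "\<tau> l \<noteq> Ear x" for x using r' by (cases "x = r") auto
        then show ?thesis using kinds l(1) by blast
      qed
    qed simp
    then show ?thesis by blast
  next
    case False
    then have rest: "\<tau> j = Split" if "j < k" "j \<noteq> i" for j using that by blast
    have "isomorphic (frame k \<tau> s) (stair k 1)"
    proof (cases r)
      case False
      show ?thesis
        by (rule stair_iso[where ear = "\<lambda>_. i"]) (use i rest False in \<open>auto simp: inj_on_def lessThan_Suc\<close>)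
    next
      case True
      \<comment> \<open>In \<open>stair k 1\<close> the ear sits at hub \<open>False\<close>;
        exchanging the hubs moves it there, and the Grundy bound passes to the isomorphic
        frame.\<close>
      let ?\<tau> = "\<lambda>i. flip (\<tau> i)" and ?s = "\<lambda>i j. s i j \<noteq> (\<tau> i = Split)"
      have iso: "isomorphic (frame k \<tau> s) (frame k ?\<tau> ?s)" by (rule frame_flip)
      obtain f where f: "bij_betw f (vset k) (vset k)"
        "\<And>u v. u \<in> vset k \<Longrightarrow> v \<in> vset k \<Longrightarrow>
          (f u, f v) \<in> parcs (frame k \<tau> s) \<longleftrightarrow> (u, v) \<in> parcs (frame k ?\<tau> ?s)"
        using isomorphic_sym[OF iso] unfolding isomorphic_def pverts_frame by blast
      have "grundy_le (frame k ?\<tau> ?s) 3"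
        using f by (intro grundy_le_embedding[OF le, of f]) (simp_all add: bij_betw_def del: parcs_frame)
      then interpret flipped: narrow_frame k ?\<tau> ?s using k by unfold_locales
      have "isomorphic (frame k ?\<tau> ?s) (stair k 1)"
        by (rule flipped.stair_iso[where ear = "\<lambda>_. i"]) (use i rest True in \<open>auto simp: inj_on_def lessThan_Suc\<close>)
      then show ?thesis using iso isomorphic_trans by blast
    qed
    then show ?thesis by blast
  qed
qed

end

section \<open>The Grundy number of the two families\<close>

text \<open>
  The graph between \<open>U\<close> and \<open>W\<close> contains no induced \<open>2K\<^sub>2\<close>, so color 2 cannot occur on both
  sides: two such vertices and their neighbors of color 1 would induce one.  The vertices of \<open>Z\<close>
  do not interfere, because \<open>a\<close> and \<open>b\<close> dominate the opposite sides.
\<close>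

lemma color_four_excluded:
  assumes "pair_graph G" and V: "pverts G = U \<union> W \<union> Z"
    and U: "\<And>u u'. u \<in> U \<Longrightarrow> u' \<in> U \<Longrightarrow> (u, u') \<notin> parcs G"
    and W: "\<And>w w'. w \<in> W \<Longrightarrow> w' \<in> W \<Longrightarrow> (w, w') \<notin> parcs G"
    and a: "a \<in> W" "\<And>u. u \<in> U \<Longrightarrow> (a, u) \<in> parcs G"
    and b: "b \<in> U" "\<And>w. w \<in> W \<Longrightarrow> (b, w) \<in> parcs G"
    and Z: "\<And>z v. z \<in> Z \<Longrightarrow> (z, v) \<in> parcs G \<Longrightarrow> v = a \<or> v = b"
    and chain: "\<And>u u' w w'. u \<in> U \<Longrightarrow> u' \<in> U \<Longrightarrow> w \<in> W \<Longrightarrow> w' \<in> W \<Longrightarrow>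
      (u, w) \<in> parcs G \<Longrightarrow> (u', w') \<in> parcs G \<Longrightarrow> (u, w') \<in> parcs G \<or> (u', w) \<in> parcs G"
    and c: "partial_grundy G (pverts G) c" and v: "v \<in> U"
  shows "c v \<noteq> 4"
proof
  interpret pair_graph G by fact
  assume v4: "c v = 4"
  have ab: "(a, b) \<in> parcs G" "(b, a) \<in> parcs G" using a b by blast+
  have proper: "c x \<noteq> c y" if "(x, y) \<in> parcs G" for x y
    using c that in_arcsD1 in_arcsD2 unfolding partial_grundy_def by blast
  have nbr: "\<exists>y. (x, y) \<in> parcs G \<and> c y = i" if "x \<in> pverts G" "1 \<le> i" "i < c x" for x i
    using c that unfolding partial_grundy_def by blast
  have not_ab: "b \<notin> W" "a \<notin> U" using a b U W ab by blast+
  have U_nbr: "y \<in> W \<or> y \<in> Z \<and> x = b" if "x \<in> U" "(x, y) \<in> parcs G" for x y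
  proof -
    have "y \<in> W \<or> y \<in> Z" using in_arcsD2[OF that(2)] U that V by blast
    moreover have "x = a \<or> x = b" if "y \<in> Z" using Z arcs_symmetric \<open>(x, y) \<in> _\<close> that by blast
    ultimately show ?thesis using not_ab that by blast
  qed
  have W_nbr: "y \<in> U \<or> y \<in> Z \<and> x = a" if "x \<in> W" "(x, y) \<in> parcs G" for x y
  proof -
    have "y \<in> U \<or> y \<in> Z" using in_arcsD2[OF that(2)] W that V by blast
    moreover have "x = a \<or> x = b" if "y \<in> Z" using Z arcs_symmetric \<open>(x, y) \<in> _\<close> that by blast
    ultimately show ?thesis using not_ab that by blast
  qed
  have one_side: False if u: "u \<in> U" "c u = 2" and w: "w \<in> W" "c w = 2" for u w
  proof -
    obtain p where p: "(u, p) \<in> parcs G" "c p = 1" using nbr[of u 1] u V by auto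
    obtain q where q: "(w, q) \<in> parcs G" "c q = 1" using nbr[of w 1] w V by auto
    have "u \<noteq> b" using proper[OF b(2)[OF w(1)]] u w by auto
    then have pW: "p \<in> W" using U_nbr[OF u(1) p(1)] by blast
    have "w \<noteq> a" using proper[OF a(2)[OF u(1)]] u w by auto
    then have qU: "q \<in> U" using W_nbr[OF w(1) q(1)] by blast
    have "(u, w) \<in> parcs G \<or> (q, p) \<in> parcs G"
      using chain[OF u(1) qU pW w(1) p(1)] arcs_symmetric[OF q(1)] by blast
    then show False using proper[of u w] proper[of q p] u w p q by auto
  qed
  obtain r where r: "(v, r) \<in> parcs G" "c r = 3" using nbr[of v 3] v v4 V by auto
  obtain t where t: "(v, t) \<in> parcs G" "c t = 2" using nbr[of v 2] v v4 V by auto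
  show False
  proof (cases "r \<in> W")
    case rW: True
    obtain t' where t': "(r, t') \<in> parcs G" "c t' = 2" using nbr[of r 2] rW r V by auto
    show False
    proof (cases "t' \<in> U")
      case True
      \<comment> \<open>With color 2 present in \<open>U\<close>, the vertex \<open>t\<close> cannot
        be in \<open>W\<close>. So it lies in \<open>Z\<close> and gives \<open>a\<close> color 1;
        but \<open>r\<close> needs a neighbor of color 1 in \<open>U\<close>, and \<open>a\<close>
        dominates \<open>U\<close>.\<close>
      then have "t \<in> Z" "v = b" using one_side t t' U_nbr[OF v t(1)] by blast+
      then obtain x where x: "(t, x) \<in> parcs G" "c x = 1" using nbr[of t 1] t V by auto
      then have "x = a" using Z[OF \<open>t \<in> Z\<close> x(1)] \<open>v = b\<close> v4 by auto
      obtain y where y: "(r, y) \<in> parcs G" "c y = 1" using nbr[of r 1] rW r V by auto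
      have "r \<noteq> a" using \<open>x = a\<close> x r by auto
      then have "y \<in> U" using W_nbr[OF rW y(1)] by blast
      then show False using proper[OF a(2)[of y]] y(2) x(2) \<open>x = a\<close> by simp
    next
      case False
      then have "t' \<in> Z" "r = a" using W_nbr[OF rW t'(1)] by blast+
      then obtain x where x: "(t', x) \<in> parcs G" "c x = 1" using nbr[of t' 1] t' V by auto
      then have b1: "c b = 1" using Z[OF \<open>t' \<in> Z\<close> x(1)] \<open>r = a\<close> r by auto
      obtain y where y: "(v, y) \<in> parcs G" "c y = 1" using nbr[of v 1] v v4 V by auto
      have "v \<noteq> b" using b1 v4 by auto
      then have "y \<in> W" using U_nbr[OF v y(1)] by blast
      then show False using proper[OF b(2)[of y]] y(2) b1 by simp
    qed
  next
    case False
    \<comment> \<open>The colors 1 and 2 seen by \<open>r\<close> would both have to be on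
      \<open>a\<close>, since its other possible neighbor \<open>b = v\<close> has color 4.\<close>
    then have rZ: "r \<in> Z" "v = b" using U_nbr[OF v r(1)] by blast+
    obtain x where x: "(r, x) \<in> parcs G" "c x = 1" using nbr[of r 1] rZ r V by auto
    obtain y where y: "(r, y) \<in> parcs G" "c y = 2" using nbr[of r 2] rZ r V by auto
    have "x = a" using Z[OF rZ(1) x(1)] x rZ v4 by auto
    moreover have "y = a" using Z[OF rZ(1) y(1)] y rZ v4 by auto
    ultimately show False using x y by simp
  qed
qed

text \<open>The hypotheses are symmetric under exchanging \<open>U\<close>, \<open>b\<close> with
  \<open>W\<close>, \<open>a\<close>, so the exclusion applies to both sides. A vertex of
  \<open>Z\<close> has at most two neighbors and cannot reach color 4.\<close>

lemma grundy_le_chain_graph: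
  assumes G: "pair_graph G" and V: "pverts G = U \<union> W \<union> Z"
    and U: "\<And>u u'. u \<in> U \<Longrightarrow> u' \<in> U \<Longrightarrow> (u, u') \<notin> parcs G"
    and W: "\<And>w w'. w \<in> W \<Longrightarrow> w' \<in> W \<Longrightarrow> (w, w') \<notin> parcs G"
    and a: "a \<in> W" "\<And>u. u \<in> U \<Longrightarrow> (a, u) \<in> parcs G"
    and b: "b \<in> U" "\<And>w. w \<in> W \<Longrightarrow> (b, w) \<in> parcs G"
    and Z: "\<And>z v. z \<in> Z \<Longrightarrow> (z, v) \<in> parcs G \<Longrightarrow> v = a \<or> v = b"
    and chain: "\<And>u u' w w'. u \<in> U \<Longrightarrow> u' \<in> U \<Longrightarrow> w \<in> W \<Longrightarrow> w' \<in> W \<Longrightarrow>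
      (u, w) \<in> parcs G \<Longrightarrow> (u', w') \<in> parcs G \<Longrightarrow> (u, w') \<in> parcs G \<or> (u', w) \<in> parcs G"
  shows "grundy_le G 3"
proof (rule grundy_leI[OF G])
  interpret pair_graph G by fact
  fix c v assume c: "partial_grundy G (pverts G) c" and "v \<in> pverts G"
  then consider "v \<in> U" | "v \<in> W" | "v \<in> Z" using V by blast
  then have "c v \<noteq> 4"
  proof cases
    case 1
    show ?thesis
      by (intro color_four_excluded[where U = U and W = W and Z = Z and a = a and b = b]; fact)
  next
    case 2
    have V': "pverts G = W \<union> U \<union> Z" using V by blast
    have chain': "(w, u') \<in> parcs G \<or> (w', u) \<in> parcs G"
      if "w \<in> W" "w' \<in> W" "u \<in> U" "u' \<in> U" "(w, u) \<in> parcs G" "(w', u') \<in> parcs G" for u u' w w'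
      using chain[of u u' w w'] that arcs_symmetric by blast
    have Z': "y = b \<or> y = a" if "z \<in> Z" "(z, y) \<in> parcs G" for z y using Z that by blast
    show ?thesis
      by (intro color_four_excluded[where U = W and W = U and Z = Z and a = b and b = a]; fact)
  next
    case 3
    show ?thesis
    proof
      assume v4: "c v = 4"
      have "\<exists>y \<in> {a, b}. c y = i" if "1 \<le> i" "i < 4" for i
        using c that 3 V Z v4 unfolding partial_grundy_def by (metis UnCI insertCI)
      from this[of 1] this[of 2] this[of 3] show False by auto
    qed
  qed
  then show "c v \<noteq> Suc 3" by simp
qed

text \<open>\<open>Z\<close> consists of the legs of ears that see the two hubs and nothing else.
  Without them the graph is bipartite and adjacency is the threshold relation
  \<open>f u < g w\<close>; thresholds make the neighborhoods nested and exclude an induced pair of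
  disjoint edges.\<close>

lemma grundy_le_stair:
  assumes e: "e = 1 \<or> e = 2" and k: "e \<le> k"
  shows "grundy_le (stair k e) 3"
proof -
  let ?\<tau> = "\<lambda>i. if i < e then Ear (i = 1) else Split"
  let ?s = "\<lambda>i j. i < e \<or> j < i \<and> \<not> (e = 2 \<and> j = 1)"
  define f where "f v = (case v of Leg i False \<Rightarrow> i | _ \<Rightarrow> 0)" for v
  \<comment> \<open>The value \<open>k\<close> exceeds \<open>f\<close> on all of \<open>U\<close>
    and marks the vertices adjacent to every vertex there, among them the ear leg at hub
    \<open>True\<close>.\<close>
  define g where "g v = (case v of Leg j True \<Rightarrow> if e = 2 \<and> j = 1 then k else j | _ \<Rightarrow> k)" for v
  have fg: "f (Hub p) = 0" "f (Leg i True) = 0" "f (Leg i False) = i"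
    "g (Hub p) = k" "g (Leg j True) = (if e = 2 \<and> j = 1 then k else j)" for p i j
    by (simp_all add: f_def g_def)
  let ?U = "{Hub True, Leg 0 True} \<union> (\<lambda>i. Leg i False) ` {e..<k}"
  let ?W = "insert (Hub False) ((\<lambda>j. Leg j True) ` {1..<k})"
  let ?Z = "(\<lambda>i. Leg i False) ` {..<e}"
  have sub: "?U \<subseteq> vset k" "?W \<subseteq> vset k" using e k by auto
  have UW: "(u, w) \<in> parcs (stair k e) \<longleftrightarrow> f u < g w" if "u \<in> ?U" "w \<in> ?W" for u w
  proof -
    have "adj ?\<tau> ?s u w \<longleftrightarrow> f u < g w" using that e k by (auto simp: fg split: if_splits)
    then show ?thesis using that sub by (auto simp: stair_def)
  qed
  have sym: "(u, w) \<in> parcs (stair k e) \<longleftrightarrow> (w, u) \<in> parcs (stair k e)" for u w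
    unfolding stair_def parcs_frame using adj_sym by blast
  show ?thesis
  proof (rule grundy_le_chain_graph[where U = ?U and W = ?W and Z = ?Z and a = "Hub False" and b = "Hub True"])
    show "pair_graph (stair k e)" unfolding stair_def by (rule pair_graph_frame)
    show "pverts (stair k e) = ?U \<union> ?W \<union> ?Z"
    proof (intro equalityI subsetI)
      fix v assume "v \<in> pverts (stair k e)"
      then have v: "v \<in> vset k" by (simp add: stair_def)
      show "v \<in> ?U \<union> ?W \<union> ?Z"
      proof (cases v)
        case (Hub p)
        then show ?thesis by (cases p) auto
      next
        case (Leg i q)
        then show ?thesis using v by (cases q; cases "i = 0"; cases "i < e") auto
      qed
    next
      fix v assume "v \<in> ?U \<union> ?W \<union> ?Z"
      then show "v \<in> pverts (stair k e)" using e k by (auto simp: stair_def)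
    qed
    show "(u, u') \<notin> parcs (stair k e)" if "u \<in> ?U" "u' \<in> ?U" for u u'
      using that e by (auto simp: stair_def)
    show "(w, w') \<notin> parcs (stair k e)" if "w \<in> ?W" "w' \<in> ?W" for w w'
      using that e by (auto simp: stair_def split: if_splits)
    show "(Hub False, u) \<in> parcs (stair k e)" if "u \<in> ?U" for u
      using UW[OF that, of "Hub False"] sym that e k by (auto simp: fg split: if_splits)
    show "(Hub True, w) \<in> parcs (stair k e)" if "w \<in> ?W" for w
      using UW[of "Hub True" w] that e k by (auto simp: fg split: if_splits)
    show "v = Hub False \<or> v = Hub True" if "z \<in> ?Z" "(z, v) \<in> parcs (stair k e)" for z v
    proof (cases v)
      case (Leg j q)
      then show ?thesis using that by (auto simp: stair_def)
    qed auto
    show "(u, w') \<in> parcs (stair k e) \<or> (u', w) \<in> parcs (stair k e)"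
      if "u \<in> ?U" "u' \<in> ?U" "w \<in> ?W" "w' \<in> ?W"
        "(u, w) \<in> parcs (stair k e)" "(u', w') \<in> parcs (stair k e)" for u u' w w'
      using that(5,6) UW[OF that(1,3)] UW[OF that(2,4)] UW[OF that(1,4)] UW[OF that(2,3)] by auto
  qed auto
qed

section \<open>Candidates among the frames\<close>

text \<open>Every leg is at distance at most two from a hub; the second alternative goes through the
  edge to another pair.\<close>

lemma frame_connected:
  assumes "\<And>i q. i < k \<Longrightarrow> (\<exists>p. hub_adj (\<tau> i) p q) \<or>
    (\<exists>j < k. j \<noteq> i \<and> s i j = q \<and> (\<exists>p. hub_adj (\<tau> j) p (s j i)))"
  shows "connected (with_proj (frame k \<tau> s))"
  unfolding pair_graph_connected_iff[OF pair_graph_frame]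
proof (intro conjI allI impI)
  have "Hub True \<in> pverts (frame k \<tau> s)" by simp
  then show "pverts (frame k \<tau> s) \<noteq> {}" by blast
  fix S assume S: "S \<subseteq> pverts (frame k \<tau> s)" "S \<noteq> {}" and
    closed: "\<forall>(u, v) \<in> parcs (frame k \<tau> s). u \<in> S \<longrightarrow> v \<in> S"
  have step: "v \<in> S" if "u \<in> S" "v \<in> vset k" "adj \<tau> s u v" for u v
  proof -
    have "(u, v) \<in> parcs (frame k \<tau> s)" using that S(1) by auto
    then show ?thesis using closed that(1) by blast
  qed
  have hubs: "Hub q \<in> S" if "Hub p \<in> S" for p q
    using step[OF that, of "Hub q"] that by (cases "p = q") auto
  have leg: "(\<exists>p. hub_adj (\<tau> i) p q) \<or> (\<exists>j < k. \<exists>r p. adj \<tau> s (Leg i q) (Leg j r) \<and> hub_adj (\<tau> j) p r)"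
    if "i < k" for i q
    using assms[OF that, of q] by auto
  obtain v where v: "v \<in> S" using S by blast
  have "\<exists>p. Hub p \<in> S"
  proof (cases v)
    case (Hub p)
    then show ?thesis using v by blast
  next
    case (Leg i q)
    then have i: "i < k" using S v by auto
    from leg[OF i, of q] show ?thesis
    proof (elim disjE exE conjE)
      fix p assume "hub_adj (\<tau> i) p q"
      then show ?thesis using step[OF v, of "Hub p"] Leg by auto
    next
      fix j r p assume j: "j < k" "adj \<tau> s (Leg i q) (Leg j r)" "hub_adj (\<tau> j) p r"
      then have "Leg j r \<in> S" using step[OF v, of "Leg j r"] Leg by simp
      then show ?thesis using step[of "Leg j r" "Hub p"] j by auto
    qed
  qed
  then have H: "Hub p \<in> S" for p using hubs by blast
  have "v \<in> S" if "v \<in> vset k" for v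
  proof (cases v)
    case (Hub p)
    then show ?thesis using H by simp
  next
    case (Leg i q)
    then have i: "i < k" using that by simp
    from leg[OF i, of q] show ?thesis
    proof (elim disjE exE conjE)
      fix p assume "hub_adj (\<tau> i) p q"
      then show ?thesis using step[OF H, of v p] Leg i by auto
    next
      fix j r p assume j: "j < k" "adj \<tau> s (Leg i q) (Leg j r)" "hub_adj (\<tau> j) p r"
      then have "Leg j r \<in> S" using step[OF H, of "Leg j r" p] by simp
      moreover have "adj \<tau> s (Leg j r) v" using j(2) Leg adj_sym[of \<tau> s v] by simp
      ultimately show ?thesis using step that by blast
    qed
  qed
  then show "S = pverts (frame k \<tau> s)" using S by auto
qed

text \<open>The hubs take colors 1 and 2 and each pair is a class of its own, with color
  \<open>i + 3\<close> because pairs are counted from 0.\<close>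

lemma frame_complete_coloring: "\<exists>c. complete_coloring (frame k \<tau> s) (k + 2) c"
proof -
  define c :: "vertex \<Rightarrow> nat" where
    "c v = (case v of Hub p \<Rightarrow> if p then 2 else 1 | Leg i q \<Rightarrow> i + 3)" for v
  have c: "c (Hub p) = (if p then 2 else 1)" "c (Leg i q) = i + 3" for p i q
    by (simp_all add: c_def)
  have range: "c v \<in> {1..k + 2}" if "v \<in> vset k" for v using that by (cases v) (auto simp: c)
  have rep: "i = 1 \<or> i = 2 \<or> (\<exists>l < k. i = l + 3)" if "i \<in> {1..k + 2}" for i
  proof -
    have "i = 1 \<or> i = 2 \<or> (i - 3 < k \<and> i = (i - 3) + 3)" using that by auto
    then show ?thesis by blast
  qed
  have hub: "\<exists>q. hub_adj t p q" for t p by (cases t) auto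
  have edge: "\<exists>(u, v) \<in> parcs (frame k \<tau> s). c u = i \<and> c v = j"
    if ij: "i \<in> {1..k + 2}" "j \<in> {1..k + 2}" "i < j" for i j
  proof -
    have "\<exists>u \<in> vset k. \<exists>v \<in> vset k. adj \<tau> s u v \<and> c u = i \<and> c v = j"
    proof (cases "\<exists>l < k. j = l + 3")
      case False
      then have "i = 1" "j = 2" using rep[OF ij(2)] ij(1,3) by auto
      then show ?thesis
        by (intro bexI[of _ "Hub False"] bexI[of _ "Hub True"]) (auto simp: c)
    next
      case True
      then obtain l where l: "l < k" "j = l + 3" by blast
      show ?thesis
      proof (cases "\<exists>m < k. i = m + 3")
        case True
        then obtain m where m: "m < k" "i = m + 3" by blast
        then show ?thesis using l ij(3)
          by (intro bexI[of _ "Leg m (s m l)"] bexI[of _ "Leg l (s l m)"]) (auto simp: c)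
      next
        case False
        then have "i = c (Hub (i = 2))" using rep[OF ij(1)] by (auto simp: c)
        moreover obtain q where "hub_adj (\<tau> l) (i = 2) q" using hub by blast
        ultimately show ?thesis using l
          by (intro bexI[of _ "Hub (i = 2)"] bexI[of _ "Leg l q"]) (auto simp: c)
      qed
    qed
    then show ?thesis by fastforce
  qed
  have "\<exists>(u, v) \<in> parcs (frame k \<tau> s). c u = i \<and> c v = j"
    if ij: "i \<in> {1..k + 2}" "j \<in> {1..k + 2}" "i \<noteq> j" for i j
  proof (cases "i < j")
    case False
    then obtain u v where "(u, v) \<in> parcs (frame k \<tau> s)" "c u = j" "c v = i"
      using edge[of j i] ij by fastforce
    then show ?thesis using adj_sym by (intro bexI[of _ "(v, u)"]) auto
  qed (use edge ij in blast)
  moreover have "c u \<noteq> c v" if "(u, v) \<in> parcs (frame k \<tau> s)" for u v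
    using that by (cases u; cases v) (auto simp: c)
  then have "proper_coloring (frame k \<tau> s) (k + 2) c"
    using range unfolding proper_coloring_def pverts_frame by blast
  moreover have "c ` vset k = {1..k + 2}"
  proof (intro equalityI subsetI)
    fix i assume "i \<in> {1..k + 2}"
    from rep[OF this] show "i \<in> c ` vset k"
    proof (elim disjE exE conjE)
      assume "i = 1" then show ?thesis by (intro image_eqI[of _ _ "Hub False"]) (auto simp: c)
    next
      assume "i = 2" then show ?thesis by (intro image_eqI[of _ _ "Hub True"]) (auto simp: c)
    next
      fix l assume "l < k" "i = l + 3"
      then show ?thesis by (intro image_eqI[of _ _ "Leg l True"]) (auto simp: c)
    qed
  qed (use range in blast)
  ultimately show ?thesis
    unfolding complete_coloring_def by (intro exI[of _ c]) simp
qed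

text \<open>Its use is to show that some complete coloring exists: the maximum in the achromatic
  number is attained only over a finite nonempty set, and first fit supplies an element.\<close>

lemma grundy_coloring_imp_complete_coloring:
  assumes "pair_graph G" "grundy_coloring G k c"
  shows "complete_coloring G k c"
proof -
  interpret pair_graph G by fact
  have *: "\<exists>u v. (u, v) \<in> parcs G \<and> c u = i \<and> c v = j"
    if ij: "i \<in> {1..k}" "j \<in> {1..k}" "j < i" for i j
  proof -
    obtain u where "u \<in> pverts G" "c u = i"
      using assms(2) ij(1) unfolding grundy_coloring_def by (metis imageE)
    then show ?thesis using assms(2) ij unfolding grundy_coloring_def by fastforce
  qed
  have "\<exists>(u, v) \<in> parcs G. c u = i \<and> c v = j"
    if ij: "i \<in> {1..k}" "j \<in> {1..k}" "i \<noteq> j" for i j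
  proof (cases "j < i")
    case False
    then have "i < j" using ij(3) by simp
    then obtain u v where "(u, v) \<in> parcs G" "c u = j" "c v = i" using *[of j i] ij by blast
    then show ?thesis using arcs_symmetric by blast
  qed (use *[of i j] ij in blast)
  then show ?thesis using assms(2) by (simp add: complete_coloring_def grundy_coloring_def)
qed

lemma candidate_complete_coloring:
  assumes "G \<in> candidate_graphs h"
  shows "\<exists>c. complete_coloring G h c" "grundy_le G 3" "pair_graph G"
    "connected (with_proj G)" "\<not> proper_coloring G 2 c"
proof -
  show G: "pair_graph G" and conn: "connected (with_proj G)"
    using assms by (simp_all add: candidate_graphs_def)
  interpret pair_graph G by fact
  show le: "grundy_le G 3"
    using assms by (intro grundy_number_le_imp[OF G]) (simp add: candidate_graphs_def)
  show "\<not> proper_coloring G 2 c"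
  proof
    assume "proper_coloring G 2 c"
    then have "chromatic_number G \<le> 2" unfolding chromatic_number_def by (intro Least_le) blast
    then show False using assms by (simp add: candidate_graphs_def)
  qed
  let ?K = "{k. \<exists>c. complete_coloring G k c}"
  have "k \<le> card (pverts G)" if "complete_coloring G k c" for k c
  proof -
    have "c ` pverts G = {1..k}" using that by (simp add: complete_coloring_def)
    then show ?thesis using card_image_le[OF pair_finite_verts, of c] by simp
  qed
  then have fin: "finite ?K" by (intro finite_subset[of ?K "{..card (pverts G)}"]) auto
  have "pverts G \<noteq> {}" using conn pair_graph_connected_iff[OF G] by blast
  moreover have "partial_grundy G {} (\<lambda>_. 0)" by (simp add: partial_grundy_def)
  ultimately have "\<exists>k c. grundy_coloring G k c"
    using partial_grundy_extend[OF G] partial_grundy_imp_grundy_coloring[OF G] by blast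
  then have "?K \<noteq> {}" using grundy_coloring_imp_complete_coloring[OF G] by blast
  then have "Max ?K \<in> ?K" using fin by (rule Max_in[rotated])
  moreover have "Max ?K = h" using assms by (simp add: candidate_graphs_def achromatic_number_def)
  ultimately show "\<exists>c. complete_coloring G h c" by simp
qed

text \<open>The upper bound on the achromatic number is pure counting: \<open>l \<ge> 4\<close>
  colors need at least \<open>2 * l - 2\<close> vertices, and there are \<open>2 * k + 2\<close>.
  Smaller \<open>l\<close> is covered by \<open>2 \<le> k\<close>.\<close>

lemma frame_candidate:
  assumes "2 \<le> k" "connected (with_proj (frame k \<tau> s))" and le: "grundy_le (frame k \<tau> s) 3"
    and tri: "(x, y) \<in> parcs (frame k \<tau> s)" "(y, z) \<in> parcs (frame k \<tau> s)"
      "(x, z) \<in> parcs (frame k \<tau> s)"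
  shows "frame k \<tau> s \<in> candidate_graphs (k + 2)"
proof -
  let ?G = "frame k \<tau> s"
  have G: "pair_graph ?G" by (rule pair_graph_frame)
  have "l \<le> k + 2" if "complete_coloring ?G l c" for l c
  proof (cases "4 \<le> l")
    case True
    then have "2 * l - 2 \<le> 2 * k + 2"
      using complete_coloring_card(1)[OF G le that] by (simp add: card_vset)
    then show ?thesis by simp
  qed (use assms(1) in simp)
  then have sub: "{l. \<exists>c. complete_coloring ?G l c} \<subseteq> {..k + 2}" by blast
  have "achromatic_number ?G = k + 2"
    unfolding achromatic_number_def
  proof (rule Max_eqI)
    show "k + 2 \<in> {l. \<exists>c. complete_coloring ?G l c}" using frame_complete_coloring by blast
  qed (use sub finite_subset in blast)+
  then show ?thesis
    using assms(2) G triangle_numbers[OF G le tri] by (simp add: candidate_graphs_def)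
qed

section \<open>Frames with two pairs\<close>

definition small :: "link \<Rightarrow> link \<Rightarrow> bool \<Rightarrow> bool \<Rightarrow> vertex pair_pre_digraph" where
  "small t0 t1 p q = frame 2 (\<lambda>i. if i = 0 then t0 else t1) (\<lambda>i j. if i = 0 then p else q)"

lemma less_two_iff: "i < 2 \<longleftrightarrow> i = 0 \<or> i = (1 :: nat)"
  by auto

lemma frame_two: "frame 2 \<tau> s = small (\<tau> 0) (\<tau> 1) (s 0 1) (s 1 0)"
  unfolding small_def by (rule frame_cong) (auto simp: less_two_iff)

lemma small_swap: "isomorphic (small t0 t1 p q) (small t1 t0 q p)"
proof -
  have "bij_betw (\<lambda>i. 1 - i) {..<2} {..<2 :: nat}"
    by (rule bij_betw_byWitness[where f' = "\<lambda>i. 1 - i"]) auto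
  from frame_perm[OF this, of "\<lambda>i. if i = 0 then t1 else t0" "\<lambda>i j. if i = 0 then q else p"]
  show ?thesis unfolding frame_two by simp
qed

lemma small_flip:
  "isomorphic (small t0 t1 p q) (small (flip t0) (flip t1) (p \<noteq> (t0 = Split)) (q \<noteq> (t1 = Split)))"
  using frame_flip[of 2 "\<lambda>i. if i = 0 then t0 else t1" "\<lambda>i j. if i = 0 then p else q"]
  unfolding frame_two by simp

lemma stair_two: "stair 2 1 = small (Ear False) Split True True"
  "stair 2 2 = small (Ear False) (Ear True) True True"
  unfolding stair_def frame_two by simp_all

text \<open>One representative for each orbit under exchanging the pairs or the hubs. The first two
  entries are \<open>stair 2 1\<close> and \<open>stair 2 2\<close>.\<close>

definition small_models :: "vertex pair_pre_digraph list" where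
  "small_models = [small (Ear False) Split True True, small (Ear False) (Ear True) True True,
     small (Ear False) Split True False, small Pendant Split True False,
     small Split Split False False, small (Ear False) (Ear False) True True,
     small (Ear False) Pendant True True]"

text \<open>Exchanging the pairs or the hubs reduces the surviving cases to the listed
  representatives. The others are excluded: \<open>Full\<close> by the Grundy bound, two pendant
  pairs by connectedness, two \<open>Split\<close> pairs with opposite ends by the chromatic
  number.\<close>

lemma small_classification:
  assumes le: "grundy_le (frame 2 \<tau> s) 3" and conn: "connected (with_proj (frame 2 \<tau> s))"
    and chi: "\<And>c. \<not> proper_coloring (frame 2 \<tau> s) 2 c"
  shows "\<exists>M \<in> set small_models. isomorphic (frame 2 \<tau> s) M"
proof -
  let ?P = "\<lambda>G. \<exists>M \<in> set small_models. isomorphic G M"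
  have swap: "?P (small t0 t1 p q)" if "?P (small t1 t0 q p)" for t0 t1 p q
    using that small_swap isomorphic_trans by blast
  have flip: "?P (small t0 t1 p q)"
    if "?P (small (flip t0) (flip t1) (p \<noteq> (t0 = Split)) (q \<noteq> (t1 = Split)))" for t0 t1 p q
    using that small_flip isomorphic_trans by blast
  have base: "?P M" if "M \<in> set small_models" for M using that isomorphic_refl by blast
  have models: "?P (small (Ear False) Split True q)" "?P (small (Ear False) (Ear r) True True)"
    "?P (small Pendant Split True False)" "?P (small Split Split False False)"
    "?P (small (Ear False) Pendant True True)" for q r
    by (rule base; cases q; cases r; simp add: small_models_def)+
  have ear: "?P (small (Ear r) Split True q)" "?P (small (Ear r) (Ear r') True True)"
    "?P (small (Ear r) Pendant True True)" for q r r'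
    using models flip[of "Ear r" Split True q] flip[of "Ear r" "Ear r'" True True]
      flip[of "Ear r" Pendant True True]
    by (cases r; simp)+
  have rest: "?P (small Pendant Split True q)" "?P (small Split Split p p)" for p q
    using models flip[of Pendant Split True True] flip[of Split Split True True]
    by (cases q; cases p; simp)+
  have not_Full: "\<tau> 0 \<noteq> Full" "\<tau> 1 \<noteq> Full" using not_Full[OF le] by simp_all
  have ends: "\<tau> 0 \<noteq> Split \<Longrightarrow> s 0 1" "\<tau> 1 \<noteq> Split \<Longrightarrow> s 1 0"
    using split_or_True[OF le, of 0 1] split_or_True[OF le, of 1 0] by auto
  have split: "s 0 1 = s 1 0" if "\<tau> 0 = Split" "\<tau> 1 = Split"
  proof (rule ccontr)
    assume "s 0 1 \<noteq> s 1 0"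
    then have "\<exists>c. proper_coloring (frame 2 \<tau> s) 2 c"
      using that by (intro split_frame_two_coloring) (auto simp: less_two_iff)
    then show False using chi by blast
  qed
  have pendant: "\<not> (\<tau> 0 = Pendant \<and> \<tau> 1 = Pendant)"
  proof
    assume "\<tau> 0 = Pendant \<and> \<tau> 1 = Pendant"
    then have "\<not> connected (with_proj (frame 2 \<tau> s))"
      using ends by (intro pendant_frame_not_connected) (auto simp: less_two_iff)
    then show False using conn by contradiction
  qed
  note swapped = ear[THEN swap] rest[THEN swap]
  show ?thesis unfolding frame_two
    using not_Full ends split pendant ear rest swapped
    by (cases "\<tau> 0"; cases "\<tau> 1") simp_all
qed

section \<open>Exhaustive search for partial Grundy colorings\<close>

definition vlist :: "nat \<Rightarrow> vertex list" where
  "vlist k = [Hub False, Hub True] @ concat (map (\<lambda>i. [Leg i False, Leg i True]) [0..<k])"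

lemma set_vlist: "set (vlist k) = vset k"
  by (auto simp: vlist_def vset_def UNIV_bool)

lemma distinct_vlist: "distinct (vlist k)"
  by (induction k) (auto simp: vlist_def)

text \<open>
  Searches for a partial Grundy coloring extending \<open>col\<close> that gives \<open>v\<close> a neighbor of color \<open>i\<close> for
  each demand \<open>(v, i)\<close>.  When the fuel runs out the answer is \<open>True\<close>, so only a negative answer is
  conclusive.
\<close>

fun search :: "nat \<Rightarrow> ('a \<Rightarrow> 'a \<Rightarrow> bool) \<Rightarrow> 'a list \<Rightarrow> ('a \<times> nat) list \<Rightarrow> ('a \<times> nat) list \<Rightarrow> bool" where
  "search 0 A vs col dem \<longleftrightarrow> True"
| "search (Suc n) A vs col [] \<longleftrightarrow> True"
| "search (Suc n) A vs col ((v, i) # dem) \<longleftrightarrow> list_ex (\<lambda>u. A v u \<and>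
     (case map_of col u of
        Some j \<Rightarrow> j = i \<and> search n A vs col dem
      | None \<Rightarrow> list_all (\<lambda>(w, j). j = i \<longrightarrow> \<not> A u w) col \<and>
          search n A vs ((u, i) # col) (map (Pair u) [1..<i] @ dem))) vs"

text \<open>An actual Grundy coloring \<open>c\<close> can be followed at every demand: the neighbor
  that it provides either already has the right color in \<open>col\<close> or can be added. Hence a
  failed search refutes \<open>c\<close>, whatever the fuel.\<close>

lemma search_complete:
  assumes proper: "\<And>u v. u \<in> set vs \<Longrightarrow> v \<in> set vs \<Longrightarrow> A u v \<Longrightarrow> c u \<noteq> c v"
    and nbr: "\<And>v i. v \<in> set vs \<Longrightarrow> 1 \<le> i \<Longrightarrow> i < c v \<Longrightarrow> \<exists>u \<in> set vs. A v u \<and> c u = i"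
    and col: "\<forall>(u, j) \<in> set col. u \<in> set vs \<and> c u = j"
    and dem: "\<forall>(v, i) \<in> set dem. v \<in> set vs \<and> 1 \<le> i \<and> i < c v"
  shows "search n A vs col dem"
  using col dem
proof (induction n arbitrary: col dem)
  case (Suc n)
  show ?case
  proof (cases dem)
    case (Cons d dem')
    obtain v i where d: "d = (v, i)" by fastforce
    then have vi: "v \<in> set vs" "1 \<le> i" "i < c v"
      and dem': "\<forall>(v, i) \<in> set dem'. v \<in> set vs \<and> 1 \<le> i \<and> i < c v"
      using Suc.prems(2) Cons by auto
    obtain u where u: "u \<in> set vs" "A v u" "c u = i" using nbr[OF vi] by blast
    have "case map_of col u of
        Some j \<Rightarrow> j = i \<and> search n A vs col dem'
      | None \<Rightarrow> list_all (\<lambda>(w, j). j = i \<longrightarrow> \<not> A u w) col \<and>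
          search n A vs ((u, i) # col) (map (Pair u) [1..<i] @ dem')"
    proof (cases "map_of col u")
      case None
      have "list_all (\<lambda>(w, j). j = i \<longrightarrow> \<not> A u w) col"
        using Suc.prems(1) proper[OF u(1)] u(3) by (fastforce simp: list_all_iff)
      moreover have "search n A vs ((u, i) # col) (map (Pair u) [1..<i] @ dem')"
        using Suc.prems(1) dem' u vi(2) by (intro Suc.IH) auto
      ultimately show ?thesis using None by simp
    next
      case (Some j)
      then have "j = i" using Suc.prems(1) u(3) map_of_SomeD by fastforce
      moreover have "search n A vs col dem'" using Suc.IH Suc.prems(1) dem' by blast
      ultimately show ?thesis using Some by simp
    qed
    then show ?thesis using u unfolding Cons d by (auto simp: list_ex_iff)
  qed simp
qed simp

lemma grundy_le_search:
  assumes "list_all (\<lambda>v. \<not> search n (adj \<tau> s) (vlist k) [(v, 4)] [(v, 3), (v, 2), (v, 1)]) (vlist k)"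
  shows "grundy_le (frame k \<tau> s) 3"
proof (rule grundy_leI[OF pair_graph_frame])
  fix c v assume c: "partial_grundy (frame k \<tau> s) (pverts (frame k \<tau> s)) c"
    and v: "v \<in> pverts (frame k \<tau> s)"
  show "c v \<noteq> Suc 3"
  proof
    assume v4: "c v = Suc 3"
    have "search n (adj \<tau> s) (vlist k) [(v, 4)] [(v, 3), (v, 2), (v, 1)]"
      by (rule search_complete[where c = c])
        (use c v v4 in \<open>auto simp: set_vlist partial_grundy_def\<close>)
    then show False using assms v by (simp add: list_all_iff set_vlist)
  qed
qed

text \<open>A vertex of color 4 creates at most seven demands, counting those of the vertices
  colored on its behalf, so fuel 12 never runs out.\<close>

lemma small_search:
  "list_all (\<lambda>(t0, t1, p, q). list_all (\<lambda>v. \<not> search 12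
      (adj (\<lambda>i. if i = 0 then t0 else t1) (\<lambda>i j. if i = 0 then p else q)) (vlist 2)
      [(v, 4)] [(v, 3), (v, 2), (v, 1)]) (vlist 2))
    [(Ear False, Split, True, False), (Pendant, Split, True, False), (Split, Split, False, False),
     (Ear False, Ear False, True, True), (Ear False, Pendant, True, True)]"
  by code_simp

lemma grundy_le_small:
  "grundy_le (small (Ear False) Split True False) 3" "grundy_le (small Pendant Split True False) 3"
  "grundy_le (small Split Split False False) 3"
  "grundy_le (small (Ear False) (Ear False) True True) 3"
  "grundy_le (small (Ear False) Pendant True True) 3"
  using small_search unfolding small_def by (auto intro!: grundy_le_search)

lemma tripod_search:
  "list_all (\<lambda>v. \<not> search 12 (adj (tri Pendant Pendant Split) (tri (\<lambda>_. True) (\<lambda>_. True) (\<lambda>j. j = 1)))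
    (vlist 3) [(v, 4)] [(v, 3), (v, 2), (v, 1)]) (vlist 3)"
  by code_simp

lemma grundy_le_tripod: "grundy_le tripod 3"
  unfolding tripod_def using tripod_search by (rule grundy_le_search)

lemma stair_candidate:
  assumes e: "e = 1 \<or> e = 2" and k: "2 \<le> k"
  shows "stair k e \<in> candidate_graphs (k + 2)"
proof -
  let ?\<tau> = "\<lambda>i. if i < e then Ear (i = 1) else Split"
  let ?s = "\<lambda>i j. i < e \<or> j < i \<and> \<not> (e = 2 \<and> j = 1)"
  have "\<exists>p. hub_adj (?\<tau> i) p q" for i q by (cases "i < e") auto
  then have "connected (with_proj (frame k ?\<tau> ?s))" by (intro frame_connected) blast
  moreover have "grundy_le (frame k ?\<tau> ?s) 3"
    using grundy_le_stair[OF e, of k] e k unfolding stair_def by auto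
  ultimately show ?thesis
    unfolding stair_def using e k
    by (intro frame_candidate[where x = "Hub False" and y = "Hub True" and z = "Leg 0 False"]) auto
qed

lemma small_models_candidate:
  assumes "M \<in> set small_models"
  shows "M \<in> candidate_graphs 4"
proof -
  have stairs: "stair 2 1 \<in> candidate_graphs 4" "stair 2 2 \<in> candidate_graphs 4"
    using stair_candidate[of 1 2] stair_candidate[of 2 2] by simp_all
  have *: "small t0 t1 p q \<in> candidate_graphs 4"
    if "connected (with_proj (small t0 t1 p q))" "grundy_le (small t0 t1 p q) 3"
      "(x, y) \<in> parcs (small t0 t1 p q)" "(y, z) \<in> parcs (small t0 t1 p q)"
      "(x, z) \<in> parcs (small t0 t1 p q)" for t0 t1 p q x y z
    using frame_candidate[OF _ that[unfolded small_def]] unfolding small_def by simp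
  have conn: "connected (with_proj (small t0 t1 p q))"
    if "\<And>r. (\<exists>p. hub_adj t0 p r) \<or> p = r \<and> (\<exists>p. hub_adj t1 p q)"
      "\<And>r. (\<exists>p. hub_adj t1 p r) \<or> q = r \<and> (\<exists>r. hub_adj t0 r p)" for t0 t1 p q
    unfolding small_def
  proof (rule frame_connected)
    fix i r assume "i < (2 :: nat)"
    then consider "i = 0" | "i = 1" by (auto simp: less_two_iff)
    then show "(\<exists>x. hub_adj (if i = 0 then t0 else t1) x r) \<or> (\<exists>j<2. j \<noteq> i \<and>
      (if i = 0 then p else q) = r \<and> (\<exists>x. hub_adj (if j = 0 then t0 else t1) x (if j = 0 then p else q)))"
    proof cases
      case 1
      then show ?thesis using that(1)[of r] by (auto intro!: exI[of "\<lambda>j. j < 2 \<and> _ j" 1])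
    next
      case 2
      then show ?thesis using that(2)[of r] by auto
    qed
  qed
  note tri = *[OF conn, where x = "Hub False" and y = "Hub True" and z = "Leg 0 False"]
  have "small (Ear False) Split True False \<in> candidate_graphs 4"
    by (rule tri[OF _ _ grundy_le_small(1)]) (simp_all add: small_def ex_bool_eq)
  moreover have "small Pendant Split True False \<in> candidate_graphs 4"
    by (rule tri[OF _ _ grundy_le_small(2)]) (simp_all add: small_def ex_bool_eq)
  \<comment> \<open>No leg sees both hubs here; the triangle consists of hub \<open>False\<close>
    and the legs \<open>False\<close> of both pairs.\<close>
  moreover have "small Split Split False False \<in> candidate_graphs 4"
    by (rule *[OF conn grundy_le_small(3), where x = "Hub False" and y = "Leg 0 False" and z = "Leg 1 False"])
      (simp_all add: small_def ex_bool_eq)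
  moreover have "small (Ear False) (Ear False) True True \<in> candidate_graphs 4"
    by (rule tri[OF _ _ grundy_le_small(4)]) (simp_all add: small_def ex_bool_eq)
  moreover have "small (Ear False) Pendant True True \<in> candidate_graphs 4"
    by (rule tri[OF _ _ grundy_le_small(5)]) (simp_all add: small_def ex_bool_eq)
  ultimately show ?thesis
    using assms stairs unfolding small_models_def stair_two by auto
qed

lemma tripod_candidate: "tripod \<in> candidate_graphs 5"
proof -
  have lt3: "m < 3 \<longleftrightarrow> m = 0 \<or> m = 1 \<or> m = 2" for m :: nat by auto
  let ?s = "tri (\<lambda>_. True) (\<lambda>_. True) (\<lambda>j. j = 1)"
  have "connected (with_proj tripod)"
    unfolding tripod_def
  proof (rule frame_connected)
    fix i q assume i: "i < (3 :: nat)"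
    have "hub_adj Split q q" "hub_adj Pendant False False" by simp_all
    then have "(\<exists>p. hub_adj (tri Pendant Pendant Split i) p q) \<or> i < 2 \<and> q" using i
      by (auto simp: lt3)
    \<comment> \<open>Leg \<open>True\<close> of a pendant pair sees no hub, but its neighbor in the
      \<open>Split\<close> pair does; hence the witness 2.\<close>
    moreover have "\<exists>j<3. j \<noteq> i \<and> ?s i j = True \<and> (\<exists>p. hub_adj (tri Pendant Pendant Split j) p (?s j i))"
      if "i < 2"
      by (rule exI[of _ 2]) (use that in \<open>auto simp: less_two_iff\<close>)
    ultimately show "(\<exists>p. hub_adj (tri Pendant Pendant Split i) p q) \<or>
        (\<exists>j<3. j \<noteq> i \<and> ?s i j = q \<and> (\<exists>p. hub_adj (tri Pendant Pendant Split j) p (?s j i)))"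
      by auto
  qed
  then have "frame 3 (tri Pendant Pendant Split) ?s \<in> candidate_graphs (3 + 2)"
    using grundy_le_tripod unfolding tripod_def
    by (intro frame_candidate[where x = "Hub False" and y = "Hub True" and z = "Leg 0 False"]) auto
  then show ?thesis unfolding tripod_def by simp
qed

section \<open>Distinguishing the models\<close>

text \<open>This counts the walks of length two from \<open>v\<close>. The set of its values is an
  isomorphism invariant that can be evaluated on concrete frames.\<close>

definition nbr_degree_sum :: "'a pair_pre_digraph \<Rightarrow> 'a \<Rightarrow> nat" where
  "nbr_degree_sum G v = (\<Sum>u \<in> {u. (v, u) \<in> parcs G}. card {w. (u, w) \<in> parcs G})"

lemma nbr_degree_sum_isomorphic:
  assumes G: "pair_graph G" and H: "pair_graph H" and iso: "isomorphic G H"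
  shows "nbr_degree_sum G ` pverts G = nbr_degree_sum H ` pverts H"
proof -
  interpret G: pair_graph G by fact
  interpret H: pair_graph H by fact
  obtain f where f: "inj_on f (pverts G)" "f ` pverts G = pverts H"
    "\<And>u v. u \<in> pverts G \<Longrightarrow> v \<in> pverts G \<Longrightarrow> (f u, f v) \<in> parcs H \<longleftrightarrow> (u, v) \<in> parcs G"
    using iso by (auto simp: isomorphic_def bij_betw_def)
  let ?N = "\<lambda>v. {u. (v, u) \<in> parcs G}" and ?M = "\<lambda>v. {u. (v, u) \<in> parcs H}"
  have sub: "?N v \<subseteq> pverts G" for v using G.in_arcsD2 by blast
  have M: "?M (f v) = f ` ?N v" if v: "v \<in> pverts G" for v
  proof (intro equalityI subsetI)
    fix y assume y: "y \<in> ?M (f v)"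
    then have "y \<in> pverts H" using H.in_arcsD2 by blast
    then obtain u where "u \<in> pverts G" "y = f u" using f(2) by blast
    then show "y \<in> f ` ?N v" using y f(3) v by blast
  next
    fix y assume "y \<in> f ` ?N v"
    then show "y \<in> ?M (f v)" using f(3) v sub by blast
  qed
  have inj: "inj_on f (?N v)" for v using f(1) sub by (rule inj_on_subset)
  have "nbr_degree_sum H (f v) = nbr_degree_sum G v" if v: "v \<in> pverts G" for v
  proof -
    have "nbr_degree_sum H (f v) = (\<Sum>u \<in> ?N v. card (?M (f u)))"
      unfolding nbr_degree_sum_def M[OF v] by (simp add: sum.reindex[OF inj])
    also have "\<dots> = (\<Sum>u \<in> ?N v. card (?N u))"
    proof (rule sum.cong)
      fix u assume "u \<in> ?N v"
      then have "u \<in> pverts G" using sub by blast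
      then show "card (?M (f u)) = card (?N u)" using M inj by (simp add: card_image)
    qed simp
    finally show ?thesis by (simp add: nbr_degree_sum_def)
  qed
  then show ?thesis unfolding f(2)[symmetric] image_image by simp
qed

definition nbr_degree_sums :: "nat \<Rightarrow> (nat \<Rightarrow> link) \<Rightarrow> (nat \<Rightarrow> nat \<Rightarrow> bool) \<Rightarrow> nat list" where
  "nbr_degree_sums k \<tau> s = map (\<lambda>v. sum_list (map (\<lambda>u. length (filter (adj \<tau> s u) (vlist k)))
     (filter (adj \<tau> s v) (vlist k)))) (vlist k)"

lemma nbr_degree_sum_frame:
  "nbr_degree_sum (frame k \<tau> s) ` pverts (frame k \<tau> s) = set (nbr_degree_sums k \<tau> s)"
proof -
  have nbrs: "{u. (v, u) \<in> parcs (frame k \<tau> s)} = set (filter (adj \<tau> s v) (vlist k))"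
    if "v \<in> vset k" for v
    using that by (auto simp: set_vlist)
  have card: "card {u. (v, u) \<in> parcs (frame k \<tau> s)} = length (filter (adj \<tau> s v) (vlist k))"
    if "v \<in> vset k" for v
    unfolding nbrs[OF that] by (rule distinct_card) (simp add: distinct_vlist)
  have "nbr_degree_sum (frame k \<tau> s) v = sum_list (map (\<lambda>u. length (filter (adj \<tau> s u) (vlist k)))
     (filter (adj \<tau> s v) (vlist k)))" if v: "v \<in> vset k" for v
  proof -
    have "nbr_degree_sum (frame k \<tau> s) v =
        (\<Sum>u \<in> set (filter (adj \<tau> s v) (vlist k)). length (filter (adj \<tau> s u) (vlist k)))"
      unfolding nbr_degree_sum_def nbrs[OF v] by (rule sum.cong[OF refl], rule card) (auto simp: set_vlist)
    then show ?thesis by (simp add: sum_list_distinct_conv_sum_set distinct_vlist)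
  qed
  then show ?thesis by (simp add: nbr_degree_sums_def set_vlist)
qed

lemma frame_not_isomorphic:
  assumes "set (nbr_degree_sums k \<tau> s) \<noteq> set (nbr_degree_sums k \<tau>' s')"
  shows "\<not> isomorphic (frame k \<tau> s) (frame k \<tau>' s')"
  using assms nbr_degree_sum_isomorphic[OF pair_graph_frame pair_graph_frame]
  unfolding nbr_degree_sum_frame by blast

text \<open>\<open>sorted_wrt\<close> relates each entry to all later ones and so expresses pairwise
  non-isomorphism. The graphs are represented by their parameters, on which the invariant can be
  computed.\<close>

lemma small_models_not_isomorphic:
  "sorted_wrt (\<lambda>G H. \<not> isomorphic G H) small_models"
proof -
  let ?\<tau> = "\<lambda>t0 t1 (i :: nat). if i = 0 then t0 else t1 :: link"
  let ?s = "\<lambda>p q (i :: nat) (j :: nat). if i = 0 then p else q :: bool"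
  let ?codes = "[(Ear False, Split, True, True), (Ear False, Ear True, True, True),
     (Ear False, Split, True, False), (Pendant, Split, True, False),
     (Split, Split, False, False), (Ear False, Ear False, True, True),
     (Ear False, Pendant, True, True)]"
  define code where "code = (\<lambda>(t0, t1, p, q). (?\<tau> t0 t1, ?s p q))"
  have "sorted_wrt (\<lambda>c d. set (case code c of (\<tau>, s) \<Rightarrow> nbr_degree_sums 2 \<tau> s) \<noteq>
      set (case code d of (\<tau>, s) \<Rightarrow> nbr_degree_sums 2 \<tau> s)) ?codes"
    unfolding code_def by code_simp
  then have "sorted_wrt (\<lambda>c d. \<not> isomorphic (case code c of (\<tau>, s) \<Rightarrow> frame 2 \<tau> s)
      (case code d of (\<tau>, s) \<Rightarrow> frame 2 \<tau> s)) ?codes"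
  proof (rule sorted_wrt_mono_rel[rotated])
    fix c d assume "set (case code c of (\<tau>, s) \<Rightarrow> nbr_degree_sums 2 \<tau> s) \<noteq>
      set (case code d of (\<tau>, s) \<Rightarrow> nbr_degree_sums 2 \<tau> s)"
    then show "\<not> isomorphic (case code c of (\<tau>, s) \<Rightarrow> frame 2 \<tau> s)
      (case code d of (\<tau>, s) \<Rightarrow> frame 2 \<tau> s)"
      by (cases "code c"; cases "code d") (simp only: prod.case frame_not_isomorphic not_False_eq_True)
  qed
  then show ?thesis by (simp add: small_models_def small_def code_def)
qed

lemma five_models_not_isomorphic:
  "sorted_wrt (\<lambda>G H. \<not> isomorphic G H) [stair 3 1, stair 3 2, tripod]"
proof -
  let ?\<tau> = "\<lambda>e i. if i < e then Ear (i = 1) else Split"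
  let ?s = "\<lambda>e i j. i < e \<or> j < i \<and> \<not> (e = 2 \<and> j = (1 :: nat))"
  let ?\<tau>' = "tri Pendant Pendant Split" and ?s' = "tri (\<lambda>_. True) (\<lambda>_. True) (\<lambda>j. j = 1)"
  have "set (nbr_degree_sums 3 (?\<tau> 1) (?s 1)) \<noteq> set (nbr_degree_sums 3 (?\<tau> 2) (?s 2))"
    "set (nbr_degree_sums 3 (?\<tau> 1) (?s 1)) \<noteq> set (nbr_degree_sums 3 ?\<tau>' ?s')"
    "set (nbr_degree_sums 3 (?\<tau> 2) (?s 2)) \<noteq> set (nbr_degree_sums 3 ?\<tau>' ?s')"
    by code_simp+
  then show ?thesis
    by (simp add: stair_def tripod_def frame_not_isomorphic del: One_nat_def)
qed

section \<open>Telling the two families apart for every \<open>h\<close>\<close>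

definition has_diamond :: "'a pair_pre_digraph \<Rightarrow> bool" where
  "has_diamond G \<longleftrightarrow> (\<exists>a b x y. x \<noteq> y \<and> (a, b) \<in> parcs G \<and>
     (a, x) \<in> parcs G \<and> (b, x) \<in> parcs G \<and> (a, y) \<in> parcs G \<and> (b, y) \<in> parcs G)"

lemma has_diamond_isomorphic:
  assumes "pair_graph G" "isomorphic G H" "has_diamond G"
  shows "has_diamond H"
proof -
  interpret pair_graph G by fact
  obtain f where f: "inj_on f (pverts G)"
    "\<And>u v. u \<in> pverts G \<Longrightarrow> v \<in> pverts G \<Longrightarrow> (f u, f v) \<in> parcs H \<longleftrightarrow> (u, v) \<in> parcs G"
    using assms(2) by (auto simp: isomorphic_def bij_betw_def)
  have arc: "(f u, f v) \<in> parcs H" if "(u, v) \<in> parcs G" for u v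
    using that f(2) in_arcsD1 in_arcsD2 by blast
  obtain a b x y where d: "x \<noteq> y" "(a, b) \<in> parcs G" "(a, x) \<in> parcs G" "(b, x) \<in> parcs G"
    "(a, y) \<in> parcs G" "(b, y) \<in> parcs G"
    using assms(3) unfolding has_diamond_def by blast
  then have "f x \<noteq> f y" using f(1) in_arcsD2 by (metis inj_onD)
  then show ?thesis unfolding has_diamond_def using d arc by blast
qed

lemma has_diamond_stair_two:
  assumes "2 \<le> k"
  shows "has_diamond (stair k 2)"
  unfolding has_diamond_def stair_def using assms
  by (intro exI[of _ "Hub False"] exI[of _ "Hub True"] exI[of _ "Leg 0 False"] exI[of _ "Leg 1 False"]) auto

text \<open>Every triangle contains leg \<open>False\<close> of the ear, since deleting it leaves a
  bipartite graph with sides given by \<open>side\<close>. Its only neighbors are the two hubs, so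
  there is a single triangle, whereas a diamond contains two.\<close>

lemma not_has_diamond_stair_one: "\<not> has_diamond (stair k 1)"
proof
  let ?E = "parcs (stair k 1)" and ?z = "Leg 0 False"
  define side where
    "side v = (case v of Hub p \<Rightarrow> p | Leg i q \<Rightarrow> (i = 0 \<or> \<not> q))" for v
  have side: "side u \<noteq> side v" if "(u, v) \<in> ?E" "u \<noteq> ?z" "v \<noteq> ?z" for u v
    using that by (cases u; cases v) (auto simp: stair_def side_def split: if_splits)
  have tri: "?z \<in> {u, v, w}" if "(u, v) \<in> ?E" "(u, w) \<in> ?E" "(v, w) \<in> ?E" for u v w
    using side[of u v] side[of u w] side[of v w] that by blast
  have z: "\<exists>p. v = Hub p" if "(?z, v) \<in> ?E" for v
    using that by (cases v) (auto simp: stair_def)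
  have hub: "p \<noteq> q" if "(Hub p, Hub q) \<in> ?E" for p q using that by (simp add: stair_def)
  have sym: "(v, u) \<in> ?E" if "(u, v) \<in> ?E" for u v using that adj_sym by (auto simp: stair_def)
  have unique: "x = y" if zb: "(?z, b) \<in> ?E" and zx: "(?z, x) \<in> ?E" and zy: "(?z, y) \<in> ?E"
    and b: "(b, x) \<in> ?E" "(b, y) \<in> ?E" for b x y
  proof -
    obtain p where p: "b = Hub p" using z[OF zb] by blast
    obtain q where q: "x = Hub q" using z[OF zx] by blast
    obtain r where r: "y = Hub r" using z[OF zy] by blast
    show ?thesis using hub[of p q] hub[of p r] b unfolding p q r by auto
  qed
  assume "has_diamond (stair k 1)"
  then obtain a b x y where d: "x \<noteq> y" "(a, b) \<in> ?E" "(a, x) \<in> ?E" "(b, x) \<in> ?E"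
    "(a, y) \<in> ?E" "(b, y) \<in> ?E"
    unfolding has_diamond_def by blast
  have "a \<noteq> ?z" using unique d by blast
  moreover have "b \<noteq> ?z" using unique[of a x y] d sym by blast
  ultimately have "x = ?z" "y = ?z"
    using tri[OF d(2,3,4)] tri[OF d(2,5,6)] by blast+
  then show False using d(1) by simp
qed

definition models :: "nat \<Rightarrow> vertex pair_pre_digraph list" where
  "models h = (if h = 4 then small_models else if h = 5 then [stair 3 1, stair 3 2, tripod]
     else [stair (h - 2) 1, stair (h - 2) 2])"

lemma models_not_isomorphic:
  assumes "4 \<le> h"
  shows "sorted_wrt (\<lambda>G H. \<not> isomorphic G H) (models h)"
proof -
  have "\<not> isomorphic (stair k 1) (stair k 2)" if "2 \<le> k" for k
  proof
    assume "isomorphic (stair k 1) (stair k 2)"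
    then have "isomorphic (stair k 2) (stair k 1)" by (rule isomorphic_sym)
    moreover have "pair_graph (stair k 2)" unfolding stair_def by (rule pair_graph_frame)
    ultimately show False
      using has_diamond_isomorphic has_diamond_stair_two[OF that] not_has_diamond_stair_one by blast
  qed
  from this[of "h - 2"] show ?thesis
    using assms small_models_not_isomorphic five_models_not_isomorphic by (simp add: models_def)
qed

lemma models_candidate:
  assumes "4 \<le> h" "M \<in> set (models h)"
  shows "M \<in> candidate_graphs h" "card (pverts M) = 2 * h - 2"
proof -
  have h: "h - 2 + 2 = h" using assms(1) by simp
  have stairs: "stair (h - 2) 1 \<in> candidate_graphs h" "stair (h - 2) 2 \<in> candidate_graphs h"
    using stair_candidate[of 1 "h - 2", unfolded h] stair_candidate[of 2 "h - 2", unfolded h] assms(1)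
    by simp_all
  show "M \<in> candidate_graphs h"
    using assms(2) small_models_candidate tripod_candidate stairs
    by (auto simp: models_def split: if_splits)
  have "pverts M = vset (h - 2)"
    using assms(2)
    by (auto simp: models_def small_models_def small_def stair_def tripod_def split: if_splits)
  then show "card (pverts M) = 2 * h - 2" using assms(1) by (simp add: card_vset)
qed

lemma candidate_card:
  assumes h: "4 \<le> h" and G: "G \<in> candidate_graphs h"
  shows "2 * h - 2 \<le> card (pverts G)"
    and "card (pverts G) = 2 * h - 2 \<Longrightarrow> \<exists>M \<in> set (models h). isomorphic G M"
proof -
  obtain c where c: "complete_coloring G h c" using candidate_complete_coloring(1)[OF G] by blast
  note G' = candidate_complete_coloring(3,2)[OF G]
  show "2 * h - 2 \<le> card (pverts G)" by (rule complete_coloring_card(1)[OF G' c h])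
  assume "card (pverts G) = 2 * h - 2"
  then obtain \<tau> s where iso: "isomorphic (frame (h - 2) \<tau> s) G"
    using exists_frame[OF G' c h] by blast
  let ?F = "frame (h - 2) \<tau> s"
  have F: "?F \<in> candidate_graphs h"
    using candidate_graphs_isomorphic[OF pair_graph_frame iso G] .
  note F' = candidate_complete_coloring(2,4,5)[OF F]
  have "\<exists>M \<in> set (models h). isomorphic ?F M"
  proof (cases "h = 4")
    case True
    then show ?thesis
      using small_classification[of \<tau> s] F' by (simp add: models_def)
  next
    case False
    then interpret narrow_frame "h - 2" \<tau> s using F'(1) h by unfold_locales simp_all
    have "h - 2 = 3 \<longleftrightarrow> h = 5" using h by auto
    then show ?thesis using classification[OF F'(2,3)] False h by (auto simp: models_def)
  qed
  then show "\<exists>M \<in> set (models h). isomorphic G M"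
    using isomorphic_trans isomorphic_sym[OF iso] by blast
qed

section \<open>Counting the isomorphism classes\<close>

lemma exists_copy:
  assumes "pair_graph M"
  shows "\<exists>G :: 'a::infinite pair_pre_digraph. pair_graph G \<and> isomorphic G M"
proof -
  interpret pair_graph M by fact
  obtain V :: "'a set" where "finite V" "card V = card (pverts M)"
    using infinite_arbitrarily_large[OF infinite_UNIV] by blast
  then obtain f where f: "bij_betw f V (pverts M)"
    using finite_same_card_bij pair_finite_verts by blast
  let ?G = "\<lparr>pverts = V, parcs = {(u, v) \<in> V \<times> V. (f u, f v) \<in> parcs M}\<rparr>"
  have "pair_graph ?G"
    unfolding pair_graph_iff using \<open>finite V\<close> arcs_symmetric no_loops'
    by (auto simp: sym_def irrefl_def)
  moreover have "isomorphic ?G M"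
    unfolding isomorphic_def using f by (intro exI[of _ f]) simp
  ultimately show ?thesis by blast
qed

text \<open>The models live on another vertex type, so a model stands for the class of all graphs
  over \<open>'a\<close> isomorphic to it. Covering and copies make these exactly the classes met by
  \<open>X\<close>, and pairwise non-isomorphism keeps them distinct.\<close>

lemma card_quotient_graph_iso_rel:
  fixes X :: "'a pair_pre_digraph set"
  assumes graphs: "\<And>G. G \<in> X \<Longrightarrow> pair_graph G"
    and cover: "\<And>G. G \<in> X \<Longrightarrow> \<exists>M \<in> set Ms. isomorphic G M"
    and copy: "\<And>M. M \<in> set Ms \<Longrightarrow> \<exists>G \<in> X. isomorphic G M"
    and diff: "sorted_wrt (\<lambda>G H. \<not> isomorphic G H) Ms"
  shows "card (X // graph_iso_rel) = length Ms"
proof -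
  define cls where "cls M = {H :: 'a pair_pre_digraph. pair_graph H \<and> isomorphic H M}" for M :: "'b pair_pre_digraph"
  have rel: "graph_iso_rel `` {G} = cls M" if "pair_graph G" "isomorphic G M" for G M
  proof -
    have "graph_iso_rel `` {G} = {H. pair_graph H \<and> isomorphic G H}"
      using that(1) digraph_iso_iff_isomorphic by (auto simp: graph_iso_rel_def)
    moreover have "isomorphic G H \<longleftrightarrow> isomorphic H M" for H :: "'a pair_pre_digraph"
      using isomorphic_trans[OF isomorphic_sym that(2)] isomorphic_trans[OF that(2) isomorphic_sym]
      by blast
    ultimately show ?thesis by (simp add: cls_def)
  qed
  have "X // graph_iso_rel = cls ` set Ms"
  proof (intro equalityI subsetI)
    fix C assume "C \<in> X // graph_iso_rel"
    then obtain G where G: "G \<in> X" "C = graph_iso_rel `` {G}" unfolding quotient_def by blast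
    then obtain M where "M \<in> set Ms" "isomorphic G M" using cover by blast
    then show "C \<in> cls ` set Ms" using rel[of G M] graphs G by blast
  next
    fix C assume "C \<in> cls ` set Ms"
    then obtain M where M: "M \<in> set Ms" "C = cls M" by blast
    then obtain G where G: "G \<in> X" "isomorphic G M" using copy by blast
    then have "C = graph_iso_rel `` {G}" using rel[of G M] graphs M(2) by blast
    then show "C \<in> X // graph_iso_rel" using G(1) by (simp add: quotientI)
  qed
  moreover have "M = M'" if M: "M \<in> set Ms" "M' \<in> set Ms" "cls M = cls M'" for M M'
  proof -
    obtain G where G: "G \<in> X" "isomorphic G M" using copy M(1) by blast
    then have "G \<in> cls M" using graphs by (simp add: cls_def)
    then have "G \<in> cls M'" unfolding M(3) .
    then have "isomorphic G M'" by (simp add: cls_def)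
    then have iso: "isomorphic M M'" by (rule isomorphic_trans[OF isomorphic_sym[OF G(2)]])
    obtain i j where ij: "i < length Ms" "Ms ! i = M" "j < length Ms" "Ms ! j = M'"
      using M by (auto simp: in_set_conv_nth)
    then have "\<not> i < j" "\<not> j < i"
      using diff iso isomorphic_sym[OF iso] by (auto simp: sorted_wrt_iff_nth_less)
    then have "i = j" by simp
    then show ?thesis using ij by simp
  qed
  then have "inj_on cls (set Ms)" by (rule inj_onI)
  moreover have "distinct Ms"
    using diff isomorphic_refl unfolding sorted_wrt_iff_nth_less distinct_conv_nth
    by (metis linorder_neqE_nat)
  ultimately show ?thesis by (simp add: card_image distinct_card)
qed

theorem theorem3:
  fixes h :: nat
  assumes "h \<ge> 4"
  shows "(\<forall>G \<in> (extremal_graphs h :: 'a::infinite pair_pre_digraph set).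
            card (pverts G) = 2 * h - 2) \<and>
         card ((extremal_graphs h :: 'a pair_pre_digraph set) // graph_iso_rel) =
           (if h = 4 then 7 else if h = 5 then 3 else 2)"
proof -
  have copy: "\<exists>G :: 'a pair_pre_digraph. G \<in> candidate_graphs h \<and> card (pverts G) = 2 * h - 2 \<and>
      isomorphic G M" if M: "M \<in> set (models h)" for M
  proof -
    have cand: "M \<in> candidate_graphs h" by (rule models_candidate(1)[OF assms M])
    then obtain G :: "'a pair_pre_digraph" where G: "pair_graph G" "isomorphic G M"
      using exists_copy candidate_complete_coloring(3) by blast
    then have "card (pverts G) = card (pverts M)"
      unfolding isomorphic_def by (auto dest: bij_betw_same_card)
    then show ?thesis
      using candidate_graphs_isomorphic[OF G cand] G(2) models_candidate(2)[OF assms M] by auto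
  qed
  \<comment> \<open>A copy of any model attains the lower bound, which turns minimality into an
    exact vertex count.\<close>
  have "models h \<noteq> []" by (simp add: models_def small_models_def)
  then obtain G0 :: "'a pair_pre_digraph" where G0:
    "G0 \<in> candidate_graphs h" "card (pverts G0) = 2 * h - 2"
    using copy[of "hd (models h)"] by auto
  have ext: "G \<in> extremal_graphs h \<longleftrightarrow> G \<in> candidate_graphs h \<and> card (pverts G) = 2 * h - 2"
    for G :: "'a pair_pre_digraph"
  proof
    assume "G \<in> extremal_graphs h"
    then have "G \<in> candidate_graphs h" "card (pverts G) \<le> card (pverts G0)"
      using G0 by (auto simp: extremal_graphs_def)
    then show "G \<in> candidate_graphs h \<and> card (pverts G) = 2 * h - 2"
      using candidate_card(1)[OF assms, of G] G0(2) by simp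
  next
    assume "G \<in> candidate_graphs h \<and> card (pverts G) = 2 * h - 2"
    then show "G \<in> extremal_graphs h"
      by (auto simp: extremal_graphs_def intro: candidate_card(1)[OF assms])
  qed
  have "card ((extremal_graphs h :: 'a pair_pre_digraph set) // graph_iso_rel) = length (models h)"
  proof (rule card_quotient_graph_iso_rel)
    show "pair_graph G" if "G \<in> extremal_graphs h" for G :: "'a pair_pre_digraph"
      using that ext by (simp add: candidate_graphs_def)
    show "\<exists>M \<in> set (models h). isomorphic G M" if "G \<in> extremal_graphs h" for G :: "'a pair_pre_digraph"
      using that ext candidate_card(2)[OF assms] by blast
    show "\<exists>G \<in> extremal_graphs h. isomorphic (G :: 'a pair_pre_digraph) M" if "M \<in> set (models h)" for M
      using copy[OF that] ext by blast
    show "sorted_wrt (\<lambda>G H. \<not> isomorphic G H) (models h)" by (rule models_not_isomorphic[OF assms])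
  qed
  then show ?thesis using ext by (simp add: models_def small_models_def)
qed

end
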